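(* Let $K\ge 1$ be an integer. For every non-negative rate vector $\mathbf{R}^*=(R^*_1,\ldots,R^*_K)$, the latent capacity region for symmetric broadcast implied by $\mathbf{R}^*$ is $$\mathcal{C}(R^*_1,\ldots,R^*_K)=\mathcal{C}^*(R^*_1,\ldots,R^*_K).$$ That is, the set $\mathcal{C}^*(\mathbf{R}^* )$ satisfies both (i) for every $K$-user broadcast channel $p$, if $\mathbf{R}^*\in\mathcal{C}_p$ then $\mathcal{C}^*(\mathbf{R}^* )\subseteq\mathcal{C}_p$; and (ii) there exists a set of $K$-user broadcast channels $\{p_x\}$ such that $\mathbf{R}^*\in\mathcal{C}_{p_x}$ for every $x$ and $\mathcal{C}^*(\mathbf{R}^* )\supseteq\bigcap_x\mathcal{C}_{p_x}$.
   Context: Notation: $\mathcal{I}_M=\{1,2,\ldots,M\}$. Broadcast channel. A $K$-user broadcast channel $p$ has an input alphabet $\mathscr{X}$, output alphabets $\mathscr{Y}_1,\ldots,\mathscr{Y}_K$ (discrete or continuous), and is given by a conditional distribution $p(y_1[1,2,\ldots],\ldots,y_K[1,2,\ldots]\,|\,x[1,2,\ldots])$ of the $K$ output sequences given the input sequence (the bracket is the time index), which for each $n$ specifies the conditional distribution of $(y_1^n,\ldots,y_K^n)$ given $x^n$. The channel may be memoryless or may have memory. Symmetric broadcast code. For non-negative $\mathbf{R}=(R_1,\ldots,R_K)$, the messages $W_{\mathcal{A}}$, $\emptyset\ne\mathcal{A}\subseteq\mathcal{I}_K$, are mutually independent, with $W_{\mathcal{A}}$ uniformly distributed on $\mathcal{I}_{2^{nR_{|\mathcal{A}|}}}$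 (with $2^{nR}$ understood as $\lfloor 2^{nR}\rfloor$ if not an integer); $W_{\mathcal{A}}$ is intended for all receivers $k\in\mathcal{A}$. An $(n,R_1,\ldots,R_K)$ symmetric broadcast code consists of an encoder $f:\prod_{\mathcal{A}}\mathcal{I}_{2^{nR_{|\mathcal{A}|}}}\to\mathscr{X}^n$ and $K$ decoders $g_k:\mathscr{Y}_k^n\to\prod_{\mathcal{A}:k\in\mathcal{A}}\mathcal{I}_{2^{nR_{|\mathcal{A}|}}}$, yielding decoded messages $\hat W_{k,\mathcal{A}}$ for $k\in\mathcal{A}$. Its error probability is $P_e^{(n)}=\Pr\big(\bigcup_{k=1}^K\bigcup_{\mathcal{A}:k\in\mathcal{A}}\{W_{\mathcal{A}}\ne\hat W_{k,\mathcal{A}}\}\big)$. The vector $\mathbf{R}$ is symmetrically achievable on $p$ if there is a sequence of $(n,\mathbf{R})$ codes with $P_e^{(n)}\to0$ as $n\to\infty$. The symmetric broadcast capacity region $\mathcal{C}_p$ is the closure of the set of symmetrically achievable rate vectors. Latent capacity region. For a given $\mathbf{R}^*$, a collection $\mathcal{R}(\mathbf{R}^* )$ of rate vectors is called the latent capacity region for symmetric broadcast implied by $\mathbf{R}^*$, denoted $\mathcal{C}(\mathbf{R}^* )$, if (i) for any $K$-user broadcast channel $p$, $\mathbf{R}^*\in\mathcal{C}_p$ implies $\mathcal{R}(\mathbf{R}^* )\subseteq\mathcal{C}_p$; and (ii) there exists a set of channels $\{p_x\}$ such that $\mathbf{R}^*\in\mathcal{C}_{p_x}$ for all $x$ and $\mathcal{R}(\mathbf{R}^*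 )\supseteq\bigcap_x\mathcal{C}_{p_x}$. (Such a region is unique and equals $\bigcap_{p:\mathbf{R}^*\in\mathcal{C}_p}\mathcal{C}_p$.) Exchange rates. For $i,j\in\mathcal{I}_K$: $\phi_{i,j}=\binom{K-i}{j-i}^{-1}\binom{j-1}{j-i}$ if $i<j$; $\phi_{i,j}=\binom{i}{i-j}^{-1}\binom{K-j}{i-j}$ if $i>j$; $\phi_{i,i}=1$. The region $\mathcal{C}^*(\mathbf{R}^* )$ is the set of vectors $\mathbf{R}=(R_1,\ldots,R_K)$ for which there exist $K^2$ non-negative quantities $r_{i,j}$, $(i,j)\in\mathcal{I}_K\times\mathcal{I}_K$, with $$R^*_i\ge\sum_{j=1}^K r_{i,j}\quad(i=1,\ldots,K),\qquad 0\le R_j\le\sum_{i=1}^K\phi_{i,j}r_{i,j}\quad(j=1,\ldots,K).$$ *)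

theory Defs
  imports "HOL-Probability.Probability"
begin

text \<open>
  Rate vectors for \<open>K\<close> users are functions on \<open>{1..K}\<close>, extensional outside it. Alphabets are
  measurable spaces (discrete alphabets being \<^const>\<open>count_space\<close>s) whose underlying sets
  may be arbitrary subsets of the types \<open>'a\<close> (input letters) and \<open>'b\<close> (output letters).
  Time starts at \<open>0\<close>, so blocks of length \<open>n\<close> are indexed by \<open>{..<n}\<close>.
\<close>

record ('a, 'b) channel =
  input_alphabet :: "'a measure"
  output_alphabet :: "nat \<Rightarrow> 'b measure"
  channel_law :: "(nat \<Rightarrow> 'a) \<Rightarrow> (nat \<Rightarrow> nat \<Rightarrow> 'b) measure"

definition input_space :: "('a, 'b) channel \<Rightarrow> nat set \<Rightarrow> (nat \<Rightarrow> 'a) measure" where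
  "input_space p T = (\<Pi>\<^sub>M t\<in>T. input_alphabet p)"

definition user_space :: "('a, 'b) channel \<Rightarrow> nat set \<Rightarrow> nat \<Rightarrow> (nat \<Rightarrow> 'b) measure" where
  "user_space p T k = (\<Pi>\<^sub>M t\<in>T. output_alphabet p k)"

definition output_space ::
    "nat \<Rightarrow> ('a, 'b) channel \<Rightarrow> nat set \<Rightarrow> (nat \<Rightarrow> nat \<Rightarrow> 'b) measure" where
  "output_space K p T = (\<Pi>\<^sub>M k\<in>{1..K}. user_space p T k)"

definition first_outputs :: "nat \<Rightarrow> nat \<Rightarrow> (nat \<Rightarrow> nat \<Rightarrow> 'b) \<Rightarrow> (nat \<Rightarrow> nat \<Rightarrow> 'b)" where
  "first_outputs K n y = (\<lambda>k\<in>{1..K}. restrict (y k) {..<n})"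

definition first_outputs_law ::
    "nat \<Rightarrow> ('a, 'b) channel \<Rightarrow> nat \<Rightarrow> (nat \<Rightarrow> 'a) \<Rightarrow> (nat \<Rightarrow> nat \<Rightarrow> 'b) measure" where
  "first_outputs_law K p n x =
     distr (channel_law p x) (output_space K p {..<n}) (first_outputs K n)"

text \<open>
  A channel is a probability kernel from input sequences to \<open>K\<close>-tuples of output sequences
  (with arbitrary memory and arbitrary dependence between the users). The last condition says that
  for each \<open>n\<close> the kernel determines the law of the first \<open>n\<close> outputs given the first \<open>n\<close> inputs.
\<close>

definition is_broadcast_channel :: "nat \<Rightarrow> ('a, 'b) channel \<Rightarrow> bool" where
  "is_broadcast_channel K p \<longleftrightarrow>
     space (input_alphabet p) \<noteq> {} \<and>
     channel_law p \<in> input_space p UNIV \<rightarrow>\<^sub>M prob_algebra (output_space K p UNIV) \<and>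
     (\<forall>n. \<forall>x\<in>space (input_space p UNIV). \<forall>x'\<in>space (input_space p UNIV).
        (\<forall>t<n. x t = x' t) \<longrightarrow> first_outputs_law K p n x = first_outputs_law K p n x')"

text \<open>
  The law of \<open>(y\<^sub>1\<^sup>n, \<dots>, y\<^sub>K\<^sup>n)\<close> given \<open>x\<^sup>n\<close>. By the last condition above, it does not
  matter with which letters \<open>x\<^sup>n\<close> is continued.
\<close>

definition block_law ::
    "nat \<Rightarrow> ('a, 'b) channel \<Rightarrow> nat \<Rightarrow> (nat \<Rightarrow> 'a) \<Rightarrow> (nat \<Rightarrow> nat \<Rightarrow> 'b) measure" where
  "block_law K p n x =
     first_outputs_law K p n
       (\<lambda>t. if t < n then x t else (SOME a. a \<in> space (input_alphabet p)))"

definition receiver_sets :: "nat \<Rightarrow> nat set set" where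
  "receiver_sets K = {A. A \<subseteq> {1..K} \<and> A \<noteq> {}}"

definition message_set :: "nat \<Rightarrow> (nat \<Rightarrow> real) \<Rightarrow> nat set \<Rightarrow> nat set" where
  "message_set n R A = {1..nat \<lfloor>2 powr (real n * R (card A))\<rfloor>}"

text \<open>The messages are independent and uniformly distributed.\<close>

definition message_pmf :: "nat \<Rightarrow> nat \<Rightarrow> (nat \<Rightarrow> real) \<Rightarrow> (nat set \<Rightarrow> nat) pmf" where
  "message_pmf K n R =
     Pi_pmf (receiver_sets K) undefined (\<lambda>A. pmf_of_set (message_set n R A))"

definition is_code ::
    "nat \<Rightarrow> ('a, 'b) channel \<Rightarrow> nat \<Rightarrow> (nat \<Rightarrow> real) \<Rightarrow>
     ((nat set \<Rightarrow> nat) \<Rightarrow> (nat \<Rightarrow> 'a)) \<Rightarrow> (nat \<Rightarrow> (nat \<Rightarrow> 'b) \<Rightarrow> (nat set \<Rightarrow> nat)) \<Rightarrow> bool" where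
  "is_code K p n R f g \<longleftrightarrow>
     f \<in> (\<Pi>\<^sub>E A\<in>receiver_sets K. message_set n R A) \<rightarrow> space (input_space p {..<n}) \<and>
     (\<forall>k\<in>{1..K}. g k \<in> user_space p {..<n} k \<rightarrow>\<^sub>M
        count_space (\<Pi>\<^sub>E A\<in>{A\<in>receiver_sets K. k \<in> A}. message_set n R A))"

definition error_probability ::
    "nat \<Rightarrow> ('a, 'b) channel \<Rightarrow> nat \<Rightarrow> (nat \<Rightarrow> real) \<Rightarrow>
     ((nat set \<Rightarrow> nat) \<Rightarrow> (nat \<Rightarrow> 'a)) \<Rightarrow> (nat \<Rightarrow> (nat \<Rightarrow> 'b) \<Rightarrow> (nat set \<Rightarrow> nat)) \<Rightarrow> real" where
  "error_probability K p n R f g =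
     measure_pmf.expectation (message_pmf K n R) (\<lambda>w.
       measure (block_law K p n (f w))
         {y \<in> space (output_space K p {..<n}).
            \<exists>k\<in>{1..K}. \<exists>A\<in>receiver_sets K. k \<in> A \<and> w A \<noteq> g k (y k) A})"

definition symmetrically_achievable :: "nat \<Rightarrow> ('a, 'b) channel \<Rightarrow> (nat \<Rightarrow> real) \<Rightarrow> bool" where
  "symmetrically_achievable K p R \<longleftrightarrow>
     R \<in> {1..K} \<rightarrow>\<^sub>E {0..} \<and>
     (\<exists>f g. (\<forall>n. is_code K p n R (f n) (g n)) \<and>
            (\<lambda>n. error_probability K p n R (f n) (g n)) \<longlonglongrightarrow> 0)"

definition capacity_region :: "nat \<Rightarrow> ('a, 'b) channel \<Rightarrow> (nat \<Rightarrow> real) set" where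
  "capacity_region K p =
     product_topology (\<lambda>_. euclideanreal) {1..K} closure_of {R. symmetrically_achievable K p R}"

text \<open>
  The type argument fixes the letters from which the alphabets of all channels are drawn.
\<close>

definition is_latent_capacity_region ::
    "('a, 'b) channel itself \<Rightarrow> nat \<Rightarrow> (nat \<Rightarrow> real) \<Rightarrow> (nat \<Rightarrow> real) set \<Rightarrow> bool" where
  "is_latent_capacity_region _ K Rs S \<longleftrightarrow>
     (\<forall>p :: ('a, 'b) channel.
        is_broadcast_channel K p \<longrightarrow> Rs \<in> capacity_region K p \<longrightarrow> S \<subseteq> capacity_region K p) \<and>
     (\<exists>P :: ('a, 'b) channel set.
        (\<forall>p\<in>P. is_broadcast_channel K p \<and> Rs \<in> capacity_region K p) \<and>
        (\<Inter>p\<in>P. capacity_region K p) \<subseteq> S)"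

definition exchange_rate :: "nat \<Rightarrow> nat \<Rightarrow> nat \<Rightarrow> real" where
  "exchange_rate K i j =
     (if i < j then inverse (real ((K - i) choose (j - i))) * real ((j - 1) choose (j - i))
      else if i > j then inverse (real (i choose (i - j))) * real ((K - j) choose (i - j))
      else 1)"

definition exchange_region :: "nat \<Rightarrow> (nat \<Rightarrow> real) \<Rightarrow> (nat \<Rightarrow> real) set" where
  "exchange_region K Rs =
     {R \<in> extensional {1..K}. \<exists>r :: nat \<Rightarrow> nat \<Rightarrow> real.
        (\<forall>i\<in>{1..K}. \<forall>j\<in>{1..K}. 0 \<le> r i j) \<and>
        (\<forall>i\<in>{1..K}. (\<Sum>j=1..K. r i j) \<le> Rs i) \<and>
        (\<forall>j\<in>{1..K}. 0 \<le> R j \<and> R j \<le> (\<Sum>i=1..K. exchange_rate K i j * r i j))}"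

lemma latent_capacity_region_unique:
  assumes "is_latent_capacity_region TYPE(('a, 'b) channel) K Rs S"
  shows "S = (\<Inter>p\<in>{p :: ('a, 'b) channel.
                is_broadcast_channel K p \<and> Rs \<in> capacity_region K p}. capacity_region K p)"
  using assms unfolding is_latent_capacity_region_def by blast

lemma block_law_restrict:
  assumes p: "is_broadcast_channel K p" and x: "x \<in> space (input_space p UNIV)"
  shows "block_law K p n (restrict x {..<n}) = first_outputs_law K p n x"
proof -
  define c where "c = (SOME a. a \<in> space (input_alphabet p))"
  define z where "z = (\<lambda>t. if t < n then restrict x {..<n} t else c)"
  have c: "c \<in> space (input_alphabet p)"
    using p unfolding is_broadcast_channel_def c_def by (simp add: some_in_eq)
  have "z t \<in> space (input_alphabet p)" for t
    using x c by (auto simp: z_def input_space_def space_PiM PiE_UNIV_domain)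
  then have z: "z \<in> space (input_space p UNIV)"
    by (simp add: input_space_def space_PiM PiE_UNIV_domain)
  have zx: "\<forall>t<n. z t = x t"
    by (simp add: z_def)
  have "first_outputs_law K p n z = first_outputs_law K p n x"
    using p z x zx unfolding is_broadcast_channel_def by blast
  then show ?thesis
    by (simp only: block_law_def z_def c_def)
qed

lemma first_outputs_measurable:
  "first_outputs K n \<in> output_space K p UNIV \<rightarrow>\<^sub>M output_space K p {..<n}"
proof -
  have "(\<lambda>y. restrict (y k) {..<n}) \<in> output_space K p UNIV \<rightarrow>\<^sub>M user_space p {..<n} k"
    if k: "k \<in> {1..K}" for k
  proof -
    have c: "(\<lambda>y. y k) \<in> output_space K p UNIV \<rightarrow>\<^sub>M user_space p UNIV k"
      unfolding output_space_def using k by (rule measurable_component_singleton)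
    have "(\<lambda>z. restrict z {..<n}) \<in> user_space p UNIV k \<rightarrow>\<^sub>M user_space p {..<n} k"
      unfolding user_space_def by (rule measurable_restrict_subset) simp
    with c show ?thesis
      by (rule measurable_compose)
  qed
  then show ?thesis
    unfolding first_outputs_def output_space_def[of K p "{..<n}"] by (rule measurable_restrict)
qed

lemma error_event_measurable:
  assumes "is_code K p n R f g"
  shows "{y \<in> space (output_space K p {..<n}).
            \<exists>k\<in>{1..K}. \<exists>A\<in>receiver_sets K. k \<in> A \<and> w A \<noteq> g k (y k) A}
         \<in> sets (output_space K p {..<n})"
proof -
  have fin: "finite (receiver_sets K)"
    by (rule finite_subset[of _ "Pow {1..K}"]) (auto simp: receiver_sets_def)
  have "{y \<in> space (output_space K p {..<n}). k \<in> A \<and> w A \<noteq> g k (y k) A}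
          \<in> sets (output_space K p {..<n})" if k: "k \<in> {1..K}" for k A
  proof -
    have c: "(\<lambda>y. y k) \<in> output_space K p {..<n} \<rightarrow>\<^sub>M user_space p {..<n} k"
      unfolding output_space_def using k by (rule measurable_component_singleton)
    have g: "g k \<in> user_space p {..<n} k \<rightarrow>\<^sub>M
        count_space (\<Pi>\<^sub>E A\<in>{A\<in>receiver_sets K. k \<in> A}. message_set n R A)"
      using assms k unfolding is_code_def by blast
    have "(\<lambda>v. k \<in> A \<and> w A \<noteq> v A) \<in>
        count_space (\<Pi>\<^sub>E A\<in>{A\<in>receiver_sets K. k \<in> A}. message_set n R A)
        \<rightarrow>\<^sub>M count_space UNIV"
      by (rule measurable_count_space)
    with measurable_compose[OF c g]
    have "(\<lambda>y. k \<in> A \<and> w A \<noteq> g k (y k) A) \<in> output_space K p {..<n} \<rightarrow>\<^sub>M count_space UNIV"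
      by (rule measurable_compose)
    then show ?thesis unfolding pred_def .
  qed
  then show ?thesis
    using fin by (intro sets.sets_Collect_finite_Ex finite_atLeastAtMost)
qed

end

theory Submission
  imports Defs
begin

text \<open>
  Achievability: a code for \<open>Rs\<close> works with small error for messages that are not uniformly
  distributed, after a suitable fixed shift of the messages. So it suffices to map the new messages to
  the old ones such that every receiver recovers its new messages from its old ones. To this end a
  message for \<open>B\<close> is read as a list of polynomials, and the messages for the sets \<open>A\<close> comparable to
  \<open>B\<close> carry the values at distinct points. The exchange rate from \<open>i\<close> to \<open>j\<close> is the number of such
  \<open>A\<close> of size \<open>i\<close> that contain a given user of \<open>B\<close>, divided by the number of sets \<open>B\<close> of size \<open>j\<close>
  sharing one \<open>A\<close>.

  Converse: one channel suffices, the deterministic network in which each set \<open>A\<close> of users has its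
  own noiseless link of rate \<open>Rs (card A)\<close>. If \<open>l i\<close> is nondecreasing and \<open>l i / i\<close> is nonincreasing,
  then repeated use of Shearer's inequality, alternately on links and on messages and going down
  through the sizes, shows that the total rates weighted by \<open>l\<close> cannot exceed those of \<open>Rs\<close>. A greedy
  pass through the sizes shows that these inequalities imply membership in the exchange region, since
  the exchange rates of the total rates are \<open>min 1 (i / j)\<close>.
\<close>

section \<open>Polymatroids and entropy\<close>

text \<open>The polynomials have natural coefficients and are evaluated in the naturals. A maximum
  distance separable code over a finite field would need alphabets of prime power size, whereas the
  messages here have arbitrary sizes; the price is that values exceed coefficients by a factor that
  does not grow with the block length, which costs no rate. Such constant losses need a little spare
  rate, and a rate equal to zero has none. Zero rates are therefore kept exact, with alphabets of
  size one.

  In the converse the sizes are handled from the top because of decoding: once every link to more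
  than \<open>b\<close> users is known, a user decodes from the own links of size at most
  \<open>b\<close>. The condition on \<open>l i / i\<close> balances the Shearer steps at
  consecutive sizes; \<open>l\<close> being nondecreasing makes the coefficients of a summation by
  parts nonnegative. The entropies are those of a uniform choice among the message tuples decoded
  without error. There the messages need not be independent any more; what survives is a lower
  bound, one bit below the full sum, on the joint entropy of all messages of at least a given
  size.\<close>

locale polymatroid =
  fixes h :: "'v set \<Rightarrow> real"
  assumes mono: "S \<subseteq> T \<Longrightarrow> h S \<le> h T"
    and submodular: "h (S \<union> T) + h (S \<inter> T) \<le> h S + h T"
begin

text \<open>Submodularity is applied to \<open>S \<union> V\<close> and \<open>T\<close>; their
  intersection contains \<open>S\<close>, and monotonicity replaces it by \<open>S\<close>. The set
  \<open>V\<close> may overlap \<open>T\<close>.\<close>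

lemma marginal_antimono:
  assumes "S \<subseteq> T"
  shows "h (T \<union> V) - h T \<le> h (S \<union> V) - h S"
proof -
  have "h ((S \<union> V) \<union> T) + h ((S \<union> V) \<inter> T) \<le> h (S \<union> V) + h T"
    by (rule submodular)
  moreover have "(S \<union> V) \<union> T = T \<union> V" using assms by auto
  moreover have "h S \<le> h ((S \<union> V) \<inter> T)" using assms by (intro mono) auto
  ultimately show ?thesis by simp
qed

text \<open>Shearer's inequality, conditioned on \<open>Z\<close>.\<close>

lemma fractional_cover:
  assumes "finite V" "finite I"
    and cover: "\<And>v. v \<in> V \<Longrightarrow> c \<le> card {k\<in>I. v \<in> F k}"
  shows "real c * (h (Z \<union> V) - h Z) \<le> (\<Sum>k\<in>I. h (Z \<union> (F k \<inter> V)) - h Z)"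
  using assms(1,3)
proof (induction V)
  case empty
  then show ?case by simp
next
  case (insert v V)
  have "real c * (h (Z \<union> insert v V) - h (Z \<union> V))
      \<le> real (card {k\<in>I. v \<in> F k}) * (h (Z \<union> insert v V) - h (Z \<union> V))"
    using insert.prems by (intro mult_right_mono) (auto intro: mono simp: diff_ge_0_iff_ge)
  also have "\<dots> = (\<Sum>k\<in>{k\<in>I. v \<in> F k}. h (Z \<union> insert v V) - h (Z \<union> V))"
    by simp
  \<comment> \<open>For a set \<open>F k\<close> that contains \<open>v\<close>, the element
    \<open>v\<close> is added to the smaller base \<open>Z \<union> (F k \<inter> V)\<close>, so its
    marginal there is at least the one over all of \<open>Z \<union> V\<close>.\<close>
  also have "\<dots> \<le> (\<Sum>k\<in>{k\<in>I. v \<in> F k}. h (Z \<union> (F k \<inter> insert v V)) - h (Z \<union> (F k \<inter> V)))"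
  proof (intro sum_mono)
    fix k assume k: "k \<in> {k\<in>I. v \<in> F k}"
    have "h ((Z \<union> V) \<union> {v}) - h (Z \<union> V) \<le> h ((Z \<union> (F k \<inter> V)) \<union> {v}) - h (Z \<union> (F k \<inter> V))"
      by (rule marginal_antimono) auto
    moreover have "(Z \<union> (F k \<inter> V)) \<union> {v} = Z \<union> (F k \<inter> insert v V)" using k by auto
    ultimately show "h (Z \<union> insert v V) - h (Z \<union> V)
        \<le> h (Z \<union> (F k \<inter> insert v V)) - h (Z \<union> (F k \<inter> V))" by simp
  qed
  also have "\<dots> = (\<Sum>k\<in>I. h (Z \<union> (F k \<inter> insert v V)) - h (Z \<union> (F k \<inter> V)))"
    using assms(2) by (intro sum.mono_neutral_left) auto
  finally have "real c * (h (Z \<union> insert v V) - h (Z \<union> V))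
     \<le> (\<Sum>k\<in>I. h (Z \<union> (F k \<inter> insert v V)) - h (Z \<union> (F k \<inter> V)))" .
  moreover have "real c * (h (Z \<union> V) - h Z) \<le> (\<Sum>k\<in>I. h (Z \<union> (F k \<inter> V)) - h Z)"
    using insert by auto
  ultimately show ?case
    by (simp add: algebra_simps sum_subtractf)
qed

lemma subadditive:
  assumes "finite V"
  shows "h (Z \<union> V) - h Z \<le> (\<Sum>v\<in>V. h (Z \<union> {v}) - h Z)"
proof -
  have "real 1 * (h (Z \<union> V) - h Z) \<le> (\<Sum>k\<in>V. h (Z \<union> ({k} \<inter> V)) - h Z)"
  proof (rule fractional_cover)
    fix v assume "v \<in> V"
    then have "{k \<in> V. v \<in> {k}} = {v}" by auto
    then show "1 \<le> card {k \<in> V. v \<in> {k}}" by simp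
  qed (use assms in auto)
  also have "\<dots> = (\<Sum>v\<in>V. h (Z \<union> {v}) - h Z)"
    by (intro sum.cong) auto
  finally show ?thesis by simp
qed

lemma determined_mono:
  assumes "h (S \<union> V) = h S" "S \<subseteq> T"
  shows "h (T \<union> V) = h T"
  using marginal_antimono[OF assms(2), of V] assms(1) mono[of T "T \<union> V"] by simp

end

section \<open>Entropy of a uniform choice from a finite set\<close>

definition agreeing :: "'g set \<Rightarrow> ('g \<Rightarrow> 'v \<Rightarrow> 'x) \<Rightarrow> 'v set \<Rightarrow> 'g \<Rightarrow> 'g set" where
  "agreeing G X S g = {g'\<in>G. \<forall>v\<in>S. X g' v = X g v}"

text \<open>Shannon entropy in bits of the family \<open>X g v\<close>, \<open>v \<in> S\<close>,
  for \<open>g\<close> uniform on \<open>G\<close>. The sum runs over the outcomes \<open>g\<close>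
  and not over the values: the class of \<open>g\<close> has probability proportional to its size,
  so each summand is the surprisal of the observed value.\<close>

definition joint_entropy :: "'g set \<Rightarrow> ('g \<Rightarrow> 'v \<Rightarrow> 'x) \<Rightarrow> 'v set \<Rightarrow> real" where
  "joint_entropy G X S =
     (\<Sum>g\<in>G. log 2 (real (card G) / real (card (agreeing G X S g)))) / real (card G)"

lemma log2_le_linear: "0 < x \<Longrightarrow> log 2 x \<le> (x - 1) / ln 2" for x :: real
  unfolding log_def by (intro divide_right_mono ln_le_minus_one) auto

context
  fixes G :: "'g set" and X :: "'g \<Rightarrow> 'v \<Rightarrow> 'x"
  assumes fin: "finite G" and ne: "G \<noteq> {}"
begin

lemma finite_agreeing: "finite (agreeing G X S g)"
  using fin by (simp add: agreeing_def)

lemma card_agreeing_pos: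
  assumes "g \<in> G"
  shows "0 < card (agreeing G X S g)"
  using assms finite_agreeing by (auto simp: card_gt_0_iff agreeing_def)

lemma agreeing_eq:
  assumes "g' \<in> agreeing G X S g"
  shows "agreeing G X S g' = agreeing G X S g"
  using assms by (auto simp: agreeing_def)

lemma card_G_pos: "0 < real (card G)"
  using fin ne by (simp add: card_gt_0_iff)

lemma joint_entropy_mono:
  assumes "S \<subseteq> T"
  shows "joint_entropy G X S \<le> joint_entropy G X T"
  unfolding joint_entropy_def
proof (intro divide_right_mono sum_mono)
  fix g assume g: "g \<in> G"
  have "card (agreeing G X T g) \<le> card (agreeing G X S g)"
    using assms finite_agreeing by (intro card_mono) (auto simp: agreeing_def)
  then show "log 2 (real (card G) / real (card (agreeing G X S g)))
      \<le> log 2 (real (card G) / real (card (agreeing G X T g)))"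
    using card_agreeing_pos[OF g] card_G_pos by (intro log_mono) (auto intro!: divide_left_mono)
qed simp

lemma sum_inverse_card_agreeing_le:
  assumes "C \<subseteq> agreeing G X S a"
  shows "(\<Sum>g\<in>C. 1 / real (card (agreeing G X S g))) \<le> 1"
proof (cases "C = {}")
  case False
  have fC: "finite C" using assms finite_agreeing finite_subset by blast
  have "(\<Sum>g\<in>C. 1 / real (card (agreeing G X S g))) = (\<Sum>g\<in>C. 1 / real (card (agreeing G X S a)))"
    using assms agreeing_eq by (intro sum.cong) auto
  also have "\<dots> = real (card C) / real (card (agreeing G X S a))" by simp
  also have "\<dots> \<le> 1"
    using card_mono[OF finite_agreeing assms] by (auto simp: divide_le_eq_1)
  finally show ?thesis .
qed simp

text \<open>By \<open>log 2 x \<le> (x - 1) / ln 2\<close> it suffices that the quotient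
  \<open>?q\<close> averages to at most one over \<open>G\<close>. The numerator of
  \<open>?q g\<close> counts pairs of an \<open>a\<close> agreeing with \<open>g\<close> on
  \<open>S\<close> and a \<open>b\<close> agreeing with \<open>g\<close> on \<open>T\<close>. For
  fixed \<open>a\<close> and \<open>b\<close>, all such \<open>g\<close> lie in one class for
  \<open>S \<union> T\<close>, over which the inverse class sizes add up to at most one, while
  \<open>a\<close> and \<open>b\<close> agree on \<open>S \<inter> T\<close>. The remaining weights
  sum to \<open>card G\<close>.\<close>

lemma joint_entropy_submodular:
  "joint_entropy G X (S \<union> T) + joint_entropy G X (S \<inter> T) \<le> joint_entropy G X S + joint_entropy G X T"
proof -
  let ?c = "\<lambda>S g. real (card (agreeing G X S g))"
  let ?q = "\<lambda>g. ?c S g * ?c T g / (?c (S \<union> T) g * ?c (S \<inter> T) g)"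
  have pos: "0 < ?c S g" if "g \<in> G" for g S using card_agreeing_pos[OF that] by simp
  have "?q g = (\<Sum>a\<in>G. \<Sum>b\<in>G. if a \<in> agreeing G X S g \<and> b \<in> agreeing G X T g
      then 1 / (?c (S \<union> T) g * ?c (S \<inter> T) g) else 0)" if "g \<in> G" for g
  proof -
    have "(\<Sum>a\<in>G. \<Sum>b\<in>G. if a \<in> agreeing G X S g \<and> b \<in> agreeing G X T g
      then 1 / (?c (S \<union> T) g * ?c (S \<inter> T) g) else 0)
      = (\<Sum>a\<in>agreeing G X S g. \<Sum>b\<in>agreeing G X T g. 1 / (?c (S \<union> T) g * ?c (S \<inter> T) g))"
      using fin by (intro sum.mono_neutral_cong_right)
        (auto intro!: sum.mono_neutral_cong_right sum.neutral simp: agreeing_def split: if_splits)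
    then show ?thesis by simp
  qed
  then have "(\<Sum>g\<in>G. ?q g) = (\<Sum>g\<in>G. \<Sum>a\<in>G. \<Sum>b\<in>G. if a \<in> agreeing G X S g \<and> b \<in> agreeing G X T g
      then 1 / (?c (S \<union> T) g * ?c (S \<inter> T) g) else 0)" by simp
  also have "\<dots> = (\<Sum>a\<in>G. \<Sum>b\<in>G. \<Sum>g\<in>G. if a \<in> agreeing G X S g \<and> b \<in> agreeing G X T g
      then 1 / (?c (S \<union> T) g * ?c (S \<inter> T) g) else 0)"
    by (rule trans[OF sum.swap sum.cong[OF refl sum.swap]])
  also have "\<dots> \<le> (\<Sum>a\<in>G. \<Sum>b\<in>G. if b \<in> agreeing G X (S \<inter> T) a then 1 / ?c (S \<inter> T) a else 0)"
  proof (intro sum_mono)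
    fix a b assume ab: "a \<in> G" "b \<in> G"
    let ?C = "{g\<in>G. a \<in> agreeing G X S g \<and> b \<in> agreeing G X T g}"
    have sum_C: "(\<Sum>g\<in>G. if a \<in> agreeing G X S g \<and> b \<in> agreeing G X T g
      then 1 / (?c (S \<union> T) g * ?c (S \<inter> T) g) else 0) = (\<Sum>g\<in>?C. 1 / (?c (S \<union> T) g * ?c (S \<inter> T) g))"
      using fin by (simp add: sum.inter_filter)
    show "(\<Sum>g\<in>G. if a \<in> agreeing G X S g \<and> b \<in> agreeing G X T g
      then 1 / (?c (S \<union> T) g * ?c (S \<inter> T) g) else 0)
      \<le> (if b \<in> agreeing G X (S \<inter> T) a then 1 / ?c (S \<inter> T) a else 0)"
    proof (cases "?C = {}")
      case True
      then show ?thesis unfolding sum_C True by simp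
    next
      case False
      then obtain g0 where g0: "g0 \<in> ?C" by blast
      have sub: "?C \<subseteq> agreeing G X (S \<union> T) g0" using g0 by (auto simp: agreeing_def)
      have b: "b \<in> agreeing G X (S \<inter> T) a" using g0 by (auto simp: agreeing_def)
      have "(\<Sum>g\<in>?C. 1 / (?c (S \<union> T) g * ?c (S \<inter> T) g))
          = (\<Sum>g\<in>?C. 1 / ?c (S \<union> T) g * (1 / ?c (S \<inter> T) a))"
      proof (intro sum.cong refl)
        fix g assume "g \<in> ?C"
        then have "agreeing G X (S \<inter> T) a = agreeing G X (S \<inter> T) g"
          by (intro agreeing_eq) (auto simp: agreeing_def)
        then show "1 / (?c (S \<union> T) g * ?c (S \<inter> T) g) = 1 / ?c (S \<union> T) g * (1 / ?c (S \<inter> T) a)" by simp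
      qed
      also have "\<dots> = (\<Sum>g\<in>?C. 1 / ?c (S \<union> T) g) * (1 / ?c (S \<inter> T) a)"
        by (rule sum_distrib_right[symmetric])
      also have "\<dots> \<le> 1 * (1 / ?c (S \<inter> T) a)"
        by (intro mult_right_mono sum_inverse_card_agreeing_le[OF sub]) simp
      finally show ?thesis unfolding sum_C using b by simp
    qed
  qed
  also have "\<dots> = (\<Sum>a\<in>G. 1)"
  proof (intro sum.cong refl)
    fix a assume a: "a \<in> G"
    have "(\<Sum>b\<in>G. if b \<in> agreeing G X (S \<inter> T) a then 1 / ?c (S \<inter> T) a else 0)
       = (\<Sum>b\<in>agreeing G X (S \<inter> T) a. 1 / ?c (S \<inter> T) a)"
      using fin by (intro sum.mono_neutral_cong_right) (auto simp: agreeing_def)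
    then show "(\<Sum>b\<in>G. if b \<in> agreeing G X (S \<inter> T) a then 1 / ?c (S \<inter> T) a else 0) = 1"
      using pos[OF a] by simp
  qed
  finally have q: "(\<Sum>g\<in>G. ?q g) \<le> real (card G)" by simp
  have "(\<Sum>g\<in>G. log 2 (?q g)) \<le> (\<Sum>g\<in>G. (?q g - 1) / ln 2)"
    using pos by (intro sum_mono log2_le_linear) auto
  also have "\<dots> = ((\<Sum>g\<in>G. ?q g) - real (card G)) / ln 2"
    by (simp add: sum_divide_distrib[symmetric] sum_subtractf)
  also have "\<dots> \<le> 0" using q by (simp add: divide_le_0_iff)
  finally have le0: "(\<Sum>g\<in>G. log 2 (?q g)) \<le> 0" .
  have "(\<Sum>g\<in>G. log 2 (?q g)) = (\<Sum>g\<in>G. log 2 (real (card G) / ?c (S \<union> T) g)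
      + log 2 (real (card G) / ?c (S \<inter> T) g) - log 2 (real (card G) / ?c S g) - log 2 (real (card G) / ?c T g))"
  proof (intro sum.cong refl)
    fix g assume g: "g \<in> G"
    show "log 2 (?q g) = log 2 (real (card G) / ?c (S \<union> T) g)
      + log 2 (real (card G) / ?c (S \<inter> T) g) - log 2 (real (card G) / ?c S g) - log 2 (real (card G) / ?c T g)"
      using pos[OF g] card_G_pos by (simp add: log_divide_pos log_mult_pos)
  qed
  also have "\<dots> = real (card G) * (joint_entropy G X (S \<union> T) + joint_entropy G X (S \<inter> T)
      - joint_entropy G X S - joint_entropy G X T)"
    using card_G_pos by (simp add: joint_entropy_def sum.distrib sum_subtractf algebra_simps)
  finally have "real (card G) * (joint_entropy G X (S \<union> T) + joint_entropy G X (S \<inter> T)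
      - joint_entropy G X S - joint_entropy G X T) \<le> 0" using le0 by simp
  then show ?thesis using card_G_pos by (simp add: mult_le_0_iff)
qed

lemma joint_entropy_empty: "joint_entropy G X {} = 0"
  using card_G_pos by (simp add: joint_entropy_def agreeing_def)

lemma joint_entropy_inj:
  assumes "\<And>g g'. g \<in> G \<Longrightarrow> g' \<in> G \<Longrightarrow> (\<forall>v\<in>S. X g' v = X g v) \<Longrightarrow> g' = g"
  shows "joint_entropy G X S = log 2 (real (card G))"
proof -
  have "agreeing G X S g = {g}" if "g \<in> G" for g
    using assms that by (auto simp: agreeing_def)
  then show ?thesis using card_G_pos by (simp add: joint_entropy_def)
qed

lemma joint_entropy_determined:
  assumes "\<And>g g'. g \<in> G \<Longrightarrow> g' \<in> G \<Longrightarrow> (\<forall>v\<in>S. X g' v = X g v) \<Longrightarrow> (\<forall>v\<in>T. X g' v = X g v)"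
  shows "joint_entropy G X (S \<union> T) = joint_entropy G X S"
proof -
  have "agreeing G X (S \<union> T) g = agreeing G X S g" if "g \<in> G" for g
    using assms that by (auto simp: agreeing_def)
  then show ?thesis by (simp add: joint_entropy_def)
qed

text \<open>The same linear bound on the logarithm: the inverse class sizes add up to at most one
  for each value taken.\<close>

lemma joint_entropy_singleton_le:
  assumes sub: "(\<lambda>g. X g v) ` G \<subseteq> Y" and Y: "finite Y"
  shows "joint_entropy G X {v} \<le> log 2 (real (card Y))"
proof -
  let ?c = "\<lambda>g. real (card (agreeing G X {v} g))"
  have cY: "0 < real (card Y)" using sub ne Y by (auto simp: card_gt_0_iff)
  have pos: "0 < ?c g" if "g \<in> G" for g using card_agreeing_pos[OF that] by simp
  have "(\<Sum>g\<in>G. 1 / ?c g) = (\<Sum>y\<in>(\<lambda>g. X g v) ` G. \<Sum>g\<in>{g\<in>G. X g v = y}. 1 / ?c g)"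
    by (rule sum.image_gen[OF fin])
  also have "\<dots> \<le> (\<Sum>y\<in>(\<lambda>g. X g v) ` G. 1)"
  proof (intro sum_mono)
    fix y assume "y \<in> (\<lambda>g. X g v) ` G"
    then obtain a where "a \<in> G" "X a v = y" by auto
    then show "(\<Sum>g\<in>{g\<in>G. X g v = y}. 1 / ?c g) \<le> 1"
      by (intro sum_inverse_card_agreeing_le[where a = a]) (auto simp: agreeing_def)
  qed
  also have "\<dots> \<le> real (card Y)" using card_mono[OF Y sub] by simp
  finally have le: "(\<Sum>g\<in>G. 1 / ?c g) \<le> real (card Y)" .
  have "(\<Sum>g\<in>G. log 2 (real (card G) / ?c g)) - real (card G) * log 2 (real (card Y))
     = (\<Sum>g\<in>G. log 2 (real (card G) / ?c g / real (card Y)))"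
  proof -
    have "(\<Sum>g\<in>G. log 2 (real (card G) / ?c g / real (card Y)))
      = (\<Sum>g\<in>G. log 2 (real (card G) / ?c g) - log 2 (real (card Y)))"
      using pos card_G_pos cY by (intro sum.cong refl, subst log_divide_pos) auto
    then show ?thesis by (simp add: sum_subtractf)
  qed
  also have "\<dots> \<le> (\<Sum>g\<in>G. (real (card G) / ?c g / real (card Y) - 1) / ln 2)"
    using pos card_G_pos cY by (intro sum_mono log2_le_linear) auto
  also have "\<dots> = (real (card G) / real (card Y) * (\<Sum>g\<in>G. 1 / ?c g) - real (card G)) / ln 2"
    by (simp add: sum_divide_distrib[symmetric] sum_subtractf sum_distrib_left mult.commute)
  also have "\<dots> \<le> 0"
  proof -
    have "real (card G) / real (card Y) * (\<Sum>g\<in>G. 1 / ?c g) \<le> real (card G) / real (card Y) * real (card Y)"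
      using le by (intro mult_left_mono) auto
    then show ?thesis using cY by (simp add: divide_le_0_iff)
  qed
  finally show ?thesis
    using card_G_pos by (simp add: joint_entropy_def divide_le_eq mult.commute)
qed

end

section \<open>The entropy inequality for link networks\<close>

lemma finite_receiver_sets [simp]: "finite (receiver_sets K)"
  by (rule finite_subset[of _ "Pow {1..K}"]) (auto simp: receiver_sets_def)

lemma receiver_setsD:
  assumes "A \<in> receiver_sets K"
  shows "finite A" "A \<subseteq> {1..K}" "1 \<le> card A" "card A \<le> K"
proof -
  show s: "A \<subseteq> {1..K}" and f: "finite A"
    using assms by (auto simp: receiver_sets_def intro: finite_subset)
  show "1 \<le> card A" using assms f by (auto simp: receiver_sets_def Suc_le_eq card_gt_0_iff)
  show "card A \<le> K" using card_mono[OF _ s] by simp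
qed

lemma sum_receiver_sets_swap:
  fixes u :: "nat set \<Rightarrow> real"
  assumes "S \<subseteq> receiver_sets K"
  shows "(\<Sum>k=1..K. \<Sum>A\<in>{A\<in>S. k \<in> A}. u A) = (\<Sum>A\<in>S. real (card A) * u A)"
proof -
  have fS: "finite S" by (rule finite_subset[OF assms finite_receiver_sets])
  have "(\<Sum>k=1..K. \<Sum>A\<in>{A\<in>S. k \<in> A}. u A) = (\<Sum>A\<in>S. \<Sum>k\<in>{k\<in>{1..K}. k \<in> A}. u A)"
    using fS by (intro sum.swap_restrict) auto
  also have "\<dots> = (\<Sum>A\<in>S. real (card A) * u A)"
  proof (intro sum.cong refl)
    fix A assume "A \<in> S"
    then have "{k\<in>{1..K}. k \<in> A} = A" using assms receiver_setsD(2) by blast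
    then show "(\<Sum>k\<in>{k\<in>{1..K}. k \<in> A}. u A) = real (card A) * u A" by simp
  qed
  finally show ?thesis .
qed

text \<open>
  \<open>Inl A\<close> stands for the signal on the link heard by exactly the users in \<open>A\<close>, and \<open>Inr B\<close> for the
  message intended for the users in \<open>B\<close>.
\<close>

locale link_network = polymatroid h for h :: "(nat set + nat set) set \<Rightarrow> real" +
  fixes K :: nat and l :: "nat \<Rightarrow> real"
  assumes empty: "h {} = 0"
    and decode: "k \<in> {1..K} \<Longrightarrow>
      h (Inl ` {A\<in>receiver_sets K. k \<in> A} \<union> Inr ` {B\<in>receiver_sets K. k \<in> B})
        = h (Inl ` {A\<in>receiver_sets K. k \<in> A})"
    and l_0: "l 0 = 0"
    and l_mono: "i < K \<Longrightarrow> l i \<le> l (Suc i)"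
    and l_star: "i < K \<Longrightarrow> real i * l (Suc i) \<le> real (Suc i) * l i"
begin

abbreviation links :: "nat \<Rightarrow> (nat set + nat set) set" where
  "links b \<equiv> Inl ` {A\<in>receiver_sets K. card A = b}"

abbreviation links_from :: "nat \<Rightarrow> (nat set + nat set) set" where
  "links_from b \<equiv> Inl ` {A\<in>receiver_sets K. b \<le> card A}"

abbreviation messages :: "nat \<Rightarrow> (nat set + nat set) set" where
  "messages b \<equiv> Inr ` {B\<in>receiver_sets K. card B = b}"

abbreviation messages_from :: "nat \<Rightarrow> (nat set + nat set) set" where
  "messages_from b \<equiv> Inr ` {B\<in>receiver_sets K. b \<le> card B}"

abbreviation user_links :: "nat \<Rightarrow> nat \<Rightarrow> (nat set + nat set) set" where
  "user_links k b \<equiv> Inl ` {A\<in>receiver_sets K. k \<in> A \<and> card A \<le> b}"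

abbreviation marginal :: "(nat set + nat set) set \<Rightarrow> (nat set + nat set) set \<Rightarrow> real" where
  "marginal Z V \<equiv> h (Z \<union> V) - h Z"

text \<open>
  The weight \<open>l i\<close> of the links of size \<open>i \<le> b\<close> is split into the part \<open>l b * i / b\<close>, which pays for
  the joint signals of the single users, and a nonnegative rest.
\<close>

definition potential :: "nat \<Rightarrow> (nat set + nat set) set \<Rightarrow> real" where
  "potential b Z = l b / real b * (\<Sum>k=1..K. marginal Z (user_links k b)) +
     (\<Sum>A\<in>{A\<in>receiver_sets K. card A \<le> b}.
        (l (card A) - l b / real b * real (card A)) * marginal Z {Inl A})"

lemma l_nonneg: "i \<le> K \<Longrightarrow> 0 \<le> l i"
proof (induction i)
  case (Suc i)
  then show ?case using l_mono[of i] by simp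
qed (simp add: l_0)

lemma l_ratio:
  assumes "1 \<le> i" "i \<le> b" "b \<le> K"
  shows "l b / real b \<le> l i / real i"
  using assms(2,3,1)
proof (induction b rule: dec_induct)
  case (step n)
  have "l (Suc n) / real (Suc n) \<le> l n / real n"
    using l_star[of n] step by (simp add: field_simps)
  then show ?case using step by simp
qed simp

lemma rest_nonneg:
  assumes "1 \<le> i" "i \<le> b" "b \<le> K"
  shows "0 \<le> l i - l b / real b * real i"
  using l_ratio[OF assms] assms by (simp add: field_simps)

lemma marginal_nonneg: "0 \<le> marginal Z V"
  using mono[of Z "Z \<union> V"] by simp

lemma marginal_le:
  assumes "Z \<subseteq> Z'"
  shows "marginal Z' V \<le> marginal Z V"
  using marginal_antimono[OF assms] .

text \<open>Subadditivity for each user; the link to \<open>A\<close> is heard by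
  \<open>card A\<close> users, whence the factor. The two sides are the two ways in which
  \<open>potential\<close> spends weight that is proportional to size.\<close>

lemma sum_user_marginals_le:
  "(\<Sum>k=1..K. marginal Z (user_links k b))
     \<le> (\<Sum>A\<in>{A\<in>receiver_sets K. card A \<le> b}. real (card A) * marginal Z {Inl A})"
proof -
  have "marginal Z (user_links k b) \<le> (\<Sum>A\<in>{A\<in>{A\<in>receiver_sets K. card A \<le> b}. k \<in> A}. marginal Z {Inl A})" for k
  proof -
    have eq: "{A\<in>{A\<in>receiver_sets K. card A \<le> b}. k \<in> A} = {A\<in>receiver_sets K. k \<in> A \<and> card A \<le> b}"
      by auto
    have "marginal Z (user_links k b) \<le> (\<Sum>v\<in>user_links k b. marginal Z {v})"
      by (rule subadditive) simp
    also have "\<dots> = (\<Sum>A\<in>{A\<in>receiver_sets K. k \<in> A \<and> card A \<le> b}. marginal Z {Inl A})"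
      by (subst sum.reindex) auto
    finally show ?thesis unfolding eq .
  qed
  then have "(\<Sum>k=1..K. marginal Z (user_links k b))
    \<le> (\<Sum>k=1..K. \<Sum>A\<in>{A\<in>{A\<in>receiver_sets K. card A \<le> b}. k \<in> A}. marginal Z {Inl A})"
    by (intro sum_mono)
  also have "\<dots> = (\<Sum>A\<in>{A\<in>receiver_sets K. card A \<le> b}. real (card A) * marginal Z {Inl A})"
    by (rule sum_receiver_sets_swap) auto
  finally show ?thesis .
qed

lemma potential_0 [simp]: "potential 0 Z = 0"
proof -
  have "{A\<in>receiver_sets K. card A \<le> 0} = {}" using receiver_setsD(3) by force
  then show ?thesis by (simp add: potential_def l_0)
qed

text \<open>Revealing the links of size \<open>Suc b\<close> uses up potential. Each is heard by
  \<open>Suc b\<close> users, so Shearer's inequality and the chain rule extract their joint entropy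
  from the signals of the single users at slope \<open>l (Suc b) / real (Suc b)\<close>. The rest
  term vanishes at size \<open>Suc b\<close>. Finally the slope is raised to
  \<open>l b / real b\<close>: this moves weight from the single links to the joint signals of the
  users, whose marginals have the smaller sum.\<close>

lemma potential_links:
  assumes b: "Suc b \<le> K"
  shows "l (Suc b) * marginal Z (links (Suc b)) + potential b (Z \<union> links (Suc b)) \<le> potential (Suc b) Z"
proof -
  let ?X = "links (Suc b)"
  let ?Z = "Z \<union> ?X"
  let ?c = "l (Suc b) / real (Suc b)"
  let ?t = "\<Sum>k=1..K. marginal ?Z (user_links k b)"
  let ?u = "\<lambda>A. marginal ?Z {Inl A}"
  let ?S = "{A\<in>receiver_sets K. card A \<le> b}"
  have c: "0 \<le> ?c" using l_nonneg[OF b] by simp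
  have "real (Suc b) * marginal Z ?X \<le> (\<Sum>k=1..K. marginal Z (user_links k (Suc b) \<inter> ?X))"
  proof (rule fractional_cover)
    fix v assume "v \<in> ?X"
    then obtain A where A: "v = Inl A" "A \<in> receiver_sets K" "card A = Suc b" by auto
    then have "{k\<in>{1..K}. v \<in> user_links k (Suc b)} = A"
      using receiver_setsD(2)[OF A(2)] by auto
    then show "Suc b \<le> card {k\<in>{1..K}. v \<in> user_links k (Suc b)}" using A by simp
  qed auto
  moreover have "marginal Z (user_links k (Suc b) \<inter> ?X) + marginal ?Z (user_links k b)
      \<le> marginal Z (user_links k (Suc b))" for k
  proof -
    have "marginal ?Z (user_links k b) \<le> marginal (Z \<union> (user_links k (Suc b) \<inter> ?X)) (user_links k b)"
      by (rule marginal_le) auto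
    moreover have "(Z \<union> (user_links k (Suc b) \<inter> ?X)) \<union> user_links k b = Z \<union> user_links k (Suc b)"
      by (auto simp: le_Suc_eq)
    ultimately show ?thesis by simp
  qed
  then have "(\<Sum>k=1..K. marginal Z (user_links k (Suc b) \<inter> ?X)) + ?t
      \<le> (\<Sum>k=1..K. marginal Z (user_links k (Suc b)))"
    unfolding sum.distrib[symmetric] by (rule sum_mono)
  ultimately have "real (Suc b) * marginal Z ?X + ?t \<le> (\<Sum>k=1..K. marginal Z (user_links k (Suc b)))"
    by linarith
  then have "?c * (real (Suc b) * marginal Z ?X + ?t) \<le> ?c * (\<Sum>k=1..K. marginal Z (user_links k (Suc b)))"
    using c by (rule mult_left_mono)
  then have 1: "l (Suc b) * marginal Z ?X + ?c * ?t \<le> ?c * (\<Sum>k=1..K. marginal Z (user_links k (Suc b)))"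
    by (simp add: distrib_left)
  have "(\<Sum>A\<in>{A\<in>receiver_sets K. card A \<le> Suc b}. (l (card A) - ?c * real (card A)) * marginal Z {Inl A})
     = (\<Sum>A\<in>?S. (l (card A) - ?c * real (card A)) * marginal Z {Inl A})"
    by (rule sum.mono_neutral_right) (auto simp: le_Suc_eq)
  moreover have "(\<Sum>A\<in>?S. (l (card A) - ?c * real (card A)) * ?u A)
      \<le> (\<Sum>A\<in>?S. (l (card A) - ?c * real (card A)) * marginal Z {Inl A})"
  proof (intro sum_mono mult_left_mono)
    fix A assume "A \<in> ?S"
    then show "0 \<le> l (card A) - ?c * real (card A)"
      using receiver_setsD(3) b by (intro rest_nonneg) auto
    show "?u A \<le> marginal Z {Inl A}" by (rule marginal_le) auto
  qed
  ultimately have 2: "(\<Sum>A\<in>?S. (l (card A) - ?c * real (card A)) * ?u A)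
     \<le> (\<Sum>A\<in>{A\<in>receiver_sets K. card A \<le> Suc b}. (l (card A) - ?c * real (card A)) * marginal Z {Inl A})"
    by simp
  have 3: "potential b ?Z \<le> ?c * ?t + (\<Sum>A\<in>?S. (l (card A) - ?c * real (card A)) * ?u A)"
  proof (cases "b = 0")
    case True
    have e: "?S = {}" "\<And>k. {A\<in>receiver_sets K. k \<in> A \<and> card A \<le> b} = {}"
      using True receiver_setsD(3) by force+
    show ?thesis unfolding e using True by simp
  next
    case False
    define d where "d = l b / real b - ?c"
    have "0 \<le> d" using l_ratio[of b "Suc b"] False b by (simp add: d_def)
    then have "d * ?t \<le> d * (\<Sum>A\<in>?S. real (card A) * ?u A)"
      using sum_user_marginals_le by (rule mult_left_mono[rotated])
    moreover have "l b / real b = ?c + d" by (simp add: d_def)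
    then have "potential b ?Z = (?c + d) * ?t + (\<Sum>A\<in>?S. (l (card A) - (?c + d) * real (card A)) * ?u A)"
      unfolding potential_def by (simp only:)
    moreover have "(\<Sum>A\<in>?S. (l (card A) - (?c + d) * real (card A)) * ?u A)
      = (\<Sum>A\<in>?S. (l (card A) - ?c * real (card A)) * ?u A) - d * (\<Sum>A\<in>?S. real (card A) * ?u A)"
      unfolding sum_distrib_left sum_subtractf[symmetric] by (intro sum.cong refl) (simp only: algebra_simps)
    moreover have "(?c + d) * ?t = ?c * ?t + d * ?t" by (rule distrib_right)
    ultimately show ?thesis by linarith
  qed
  show ?thesis unfolding potential_def[of "Suc b" Z] using 1 2 3 by linarith
qed

text \<open>All links to more than \<open>b\<close> users belong to \<open>Z\<close>, so
  \<open>Z\<close> together with \<open>user_links k b\<close> determines every message for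
  \<open>k\<close>. Hence the messages of size \<open>Suc b\<close> for \<open>k\<close> are paid
  out of the marginal of \<open>user_links k b\<close>. Shearer's inequality gains a factor
  \<open>Suc b\<close>, and \<open>l_star\<close> turns the slope \<open>l b / real b\<close> into
  the weight \<open>l (Suc b)\<close>.\<close>

lemma potential_messages:
  assumes b: "Suc b \<le> K" and Z: "links_from (Suc b) \<subseteq> Z"
  shows "l (Suc b) * marginal Z (messages (Suc b)) + potential b (Z \<union> messages (Suc b)) \<le> potential b Z"
proof -
  let ?M = "messages (Suc b)"
  let ?N = "\<lambda>k. Inr ` {B\<in>receiver_sets K. k \<in> B}"
  let ?Z = "Z \<union> ?M"
  have "real (Suc b) * marginal Z ?M \<le> (\<Sum>k=1..K. marginal Z (?N k \<inter> ?M))"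
  proof (rule fractional_cover)
    fix v assume "v \<in> ?M"
    then obtain A where A: "v = Inr A" "A \<in> receiver_sets K" "card A = Suc b" by auto
    then have "{k\<in>{1..K}. v \<in> ?N k} = A"
      using receiver_setsD(2)[OF A(2)] by auto
    then show "Suc b \<le> card {k\<in>{1..K}. v \<in> ?N k}" using A by simp
  qed auto
  moreover have "marginal Z (?N k \<inter> ?M) + marginal ?Z (user_links k b) \<le> marginal Z (user_links k b)"
    if k: "k \<in> {1..K}" for k
  proof -
    let ?T = "Z \<union> user_links k b"
    have "h (?T \<union> ?N k) = h ?T"
      by (rule determined_mono[OF decode[OF k]]) (use Z in force)
    moreover have "h (?T \<union> (?N k \<inter> ?M)) \<le> h (?T \<union> ?N k)" "h ?T \<le> h (?T \<union> (?N k \<inter> ?M))"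
      by (rule mono; auto)+
    ultimately have 1: "h (?T \<union> (?N k \<inter> ?M)) = h ?T" by simp
    have "marginal ?Z (user_links k b) \<le> marginal (Z \<union> (?N k \<inter> ?M)) (user_links k b)"
      by (rule marginal_le) auto
    moreover have "(Z \<union> (?N k \<inter> ?M)) \<union> user_links k b = ?T \<union> (?N k \<inter> ?M)" by auto
    ultimately show ?thesis using 1 by simp
  qed
  then have "(\<Sum>k=1..K. marginal Z (?N k \<inter> ?M)) + (\<Sum>k=1..K. marginal ?Z (user_links k b))
      \<le> (\<Sum>k=1..K. marginal Z (user_links k b))"
    unfolding sum.distrib[symmetric] by (intro sum_mono)
  ultimately have *: "real (Suc b) * marginal Z ?M + (\<Sum>k=1..K. marginal ?Z (user_links k b))
     \<le> (\<Sum>k=1..K. marginal Z (user_links k b))" by linarith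
  show ?thesis
  proof (cases "b = 0")
    \<comment> \<open>No slope is available for \<open>b = 0\<close>, but then every link already
      lies in \<open>Z\<close>, so the messages to single users are determined and have marginal
      zero.\<close>
    case True
    have e: "{A\<in>receiver_sets K. k \<in> A \<and> card A \<le> b} = {}" for k
      using True receiver_setsD(3) by force
    have "marginal Z ?M \<le> 0" using *[unfolded e] True by simp
    then have "l (Suc b) * marginal Z ?M \<le> 0"
      using l_nonneg[OF b] by (simp add: mult_le_0_iff)
    then show ?thesis using True by simp
  next
    case False
    let ?c = "l b / real b"
    let ?S = "{A\<in>receiver_sets K. card A \<le> b}"
    have c: "0 \<le> ?c" using l_nonneg[of b] b by simp
    have "?c * (real (Suc b) * marginal Z ?M + (\<Sum>k=1..K. marginal ?Z (user_links k b)))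
       \<le> ?c * (\<Sum>k=1..K. marginal Z (user_links k b))"
      using * c by (rule mult_left_mono)
    moreover have "l (Suc b) \<le> ?c * real (Suc b)"
      using l_star[of b] b False by (simp add: field_simps)
    then have "l (Suc b) * marginal Z ?M \<le> ?c * real (Suc b) * marginal Z ?M"
      using marginal_nonneg by (rule mult_right_mono)
    moreover have "(\<Sum>A\<in>?S. (l (card A) - ?c * real (card A)) * marginal ?Z {Inl A})
      \<le> (\<Sum>A\<in>?S. (l (card A) - ?c * real (card A)) * marginal Z {Inl A})"
    proof (intro sum_mono mult_left_mono)
      fix A assume "A \<in> ?S"
      then show "0 \<le> l (card A) - ?c * real (card A)"
        using receiver_setsD(3) b by (intro rest_nonneg) auto
      show "marginal ?Z {Inl A} \<le> marginal Z {Inl A}" by (rule marginal_le) auto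
    qed
    ultimately show ?thesis unfolding potential_def by (simp only: distrib_left mult.assoc)
  qed
qed

lemma potential_telescope:
  assumes "b \<le> K"
  shows "(\<Sum>i=1..b. l i * (h (links_from i \<union> messages_from i) - h (links_from (Suc i) \<union> messages_from (Suc i))))
     \<le> potential b (links_from (Suc b) \<union> messages_from (Suc b))"
  using assms
proof (induction b)
  case (Suc b)
  let ?D = "\<lambda>i. links_from i \<union> messages_from i"
  have "{A\<in>receiver_sets K. Suc b \<le> card A}
      = {A\<in>receiver_sets K. Suc (Suc b) \<le> card A} \<union> {A\<in>receiver_sets K. card A = Suc b}" by auto
  then have eq: "links_from (Suc b) = links_from (Suc (Suc b)) \<union> links (Suc b)"
     "messages_from (Suc b) = messages_from (Suc (Suc b)) \<union> messages (Suc b)"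
    by (simp_all only: image_Un)
  have D: "?D (Suc b) = ?D (Suc (Suc b)) \<union> links (Suc b) \<union> messages (Suc b)"
    by (simp only: eq Un_ac)
  have "l (Suc b) * marginal (?D (Suc (Suc b))) (links (Suc b)) + potential b (?D (Suc (Suc b)) \<union> links (Suc b))
      \<le> potential (Suc b) (?D (Suc (Suc b)))"
    by (rule potential_links[OF Suc.prems])
  moreover have "l (Suc b) * marginal (?D (Suc (Suc b)) \<union> links (Suc b)) (messages (Suc b)) + potential b (?D (Suc b))
      \<le> potential b (?D (Suc (Suc b)) \<union> links (Suc b))"
    unfolding D by (rule potential_messages[OF Suc.prems]) (simp only: eq, blast)
  moreover have "l (Suc b) * (h (?D (Suc b)) - h (?D (Suc (Suc b))))
     = l (Suc b) * marginal (?D (Suc (Suc b))) (links (Suc b))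
       + l (Suc b) * marginal (?D (Suc (Suc b)) \<union> links (Suc b)) (messages (Suc b))"
    unfolding D by (simp add: algebra_simps)
  ultimately show ?case using Suc by simp
qed simp

lemma potential_K_le: "potential K {} \<le> (\<Sum>A\<in>receiver_sets K. l (card A) * h {Inl A})"
proof -
  let ?c = "l K / real K"
  have S: "{A\<in>receiver_sets K. card A \<le> K} = receiver_sets K" using receiver_setsD(4) by blast
  have "?c * (\<Sum>k=1..K. marginal {} (user_links k K))
    \<le> ?c * (\<Sum>A\<in>{A\<in>receiver_sets K. card A \<le> K}. real (card A) * marginal {} {Inl A})"
    using l_nonneg[of K] by (intro mult_left_mono sum_user_marginals_le) simp
  then have "potential K {} \<le> (\<Sum>A\<in>receiver_sets K. ?c * (real (card A) * h {Inl A})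
      + (l (card A) - ?c * real (card A)) * h {Inl A})"
    unfolding potential_def S sum.distrib sum_distrib_left by (simp add: empty)
  also have "\<dots> = (\<Sum>A\<in>receiver_sets K. l (card A) * h {Inl A})"
    by (intro sum.cong refl) (simp add: algebra_simps)
  finally show ?thesis .
qed

text \<open>Summation by parts turns the telescoped sum into nonnegative multiples
  \<open>d i\<close> of joint entropies, so lower bounds for the messages of size at least
  \<open>i\<close> suffice. The same loss \<open>e\<close> in each of them adds up to
  \<open>l K * e\<close>, since the differences \<open>d i\<close> sum to
  \<open>l K\<close>.\<close>

lemma weighted_link_bound:
  assumes c: "\<And>i. i \<in> {1..K} \<Longrightarrow> (\<Sum>B\<in>{B\<in>receiver_sets K. i \<le> card B}. c B) - e \<le> h (messages_from i)"
  shows "(\<Sum>B\<in>receiver_sets K. l (card B) * c B) - l K * e \<le> (\<Sum>A\<in>receiver_sets K. l (card A) * h {Inl A})"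
proof -
  define D where "D i = h (links_from i \<union> messages_from i)" for i
  define d where "d i = l i - l (i - 1)" for i
  have l_sum: "(\<Sum>i=1..b. d i) = l b" for b
    by (induction b) (simp_all add: l_0 d_def)
  have abel: "(\<Sum>i=1..b. l i * (D i - D (Suc i))) = (\<Sum>i=1..b. d i * D i) - l b * D (Suc b)" for b
  proof (induction b)
    case (Suc b)
    then show ?case by (simp add: right_diff_distrib left_diff_distrib d_def)
  qed (simp add: l_0)
  have top: "links_from (Suc K) = {}" "messages_from (Suc K) = {}" using receiver_setsD(4) by force+
  have "(\<Sum>i=1..K. d i * ((\<Sum>B\<in>{B\<in>receiver_sets K. i \<le> card B}. c B) - e)) \<le> (\<Sum>i=1..K. d i * D i)"
  proof (intro sum_mono mult_left_mono)
    fix i assume i: "i \<in> {1..K}"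
    then show "0 \<le> d i" unfolding d_def using l_mono[of "i - 1"] by (cases i) auto
    have "h (messages_from i) \<le> D i" unfolding D_def by (rule mono) auto
    then show "(\<Sum>B\<in>{B\<in>receiver_sets K. i \<le> card B}. c B) - e \<le> D i" using c[OF i] by simp
  qed
  also have "\<dots> = (\<Sum>i=1..K. l i * (D i - D (Suc i)))"
    unfolding abel by (simp add: empty D_def top)
  also have "\<dots> \<le> potential K {}"
    using potential_telescope[OF order_refl] unfolding top D_def by simp
  also note potential_K_le
  finally have bound: "(\<Sum>i=1..K. d i * ((\<Sum>B\<in>{B\<in>receiver_sets K. i \<le> card B}. c B) - e))
     \<le> (\<Sum>A\<in>receiver_sets K. l (card A) * h {Inl A})" .
  have "(\<Sum>i=1..K. d i * ((\<Sum>B\<in>{B\<in>receiver_sets K. i \<le> card B}. c B) - e))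
     = (\<Sum>i=1..K. (\<Sum>B\<in>{B\<in>receiver_sets K. i \<le> card B}. d i * c B) - d i * e)"
    by (simp only: right_diff_distrib sum_distrib_left)
  also have "\<dots> = (\<Sum>i=1..K. \<Sum>B\<in>{B\<in>receiver_sets K. i \<le> card B}. d i * c B) - l K * e"
    unfolding sum_subtractf l_sum[symmetric] by (simp only: sum_distrib_right)
  also have "(\<Sum>i=1..K. \<Sum>B\<in>{B\<in>receiver_sets K. i \<le> card B}. d i * c B)
     = (\<Sum>B\<in>receiver_sets K. \<Sum>i\<in>{i\<in>{1..K}. i \<le> card B}. d i * c B)"
    by (rule sum.swap_restrict) auto
  also have "\<dots> = (\<Sum>B\<in>receiver_sets K. l (card B) * c B)"
  proof (intro sum.cong refl)
    fix B assume B: "B \<in> receiver_sets K"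
    have eq: "{i\<in>{1..K}. i \<le> card B} = {1..card B}" using receiver_setsD(4)[OF B] by auto
    show "(\<Sum>i\<in>{i\<in>{1..K}. i \<le> card B}. d i * c B) = l (card B) * c B"
      unfolding eq l_sum[symmetric] by (rule sum_distrib_right[symmetric])
  qed
  finally show ?thesis using bound by simp
qed

end

section \<open>Conversion at given exchange rates\<close>

text \<open>
  In terms of the total rates \<open>(K choose i) * R i\<close> of all messages of one size, the exchange rate
  between the sizes \<open>i\<close> and \<open>j\<close> does not depend on \<open>K\<close>.
\<close>

definition scaled_exchange :: "nat \<Rightarrow> nat \<Rightarrow> real" where
  "scaled_exchange i j = min 1 (real i / real j)"

definition convertible :: "nat \<Rightarrow> (nat \<Rightarrow> real) \<Rightarrow> (nat \<Rightarrow> real) \<Rightarrow> bool" where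
  "convertible m s d \<longleftrightarrow> (\<exists>r. (\<forall>i\<in>{1..m}. \<forall>j\<in>{1..m}. 0 \<le> r i j) \<and>
     (\<forall>i\<in>{1..m}. (\<Sum>j=1..m. r i j) \<le> s i) \<and>
     (\<forall>j\<in>{1..m}. d j \<le> (\<Sum>i=1..m. scaled_exchange i j * r i j)))"

text \<open>The prices of total rates at which no exchange makes a profit: going down in size has
  rate \<open>1\<close>, so prices must not decrease, and going up by one has rate
  \<open>i / (i + 1)\<close>, so the price divided by the size must not increase. The value
  \<open>l 0\<close> is free apart from its sign.\<close>

definition price_cone :: "nat \<Rightarrow> (nat \<Rightarrow> real) set" where
  "price_cone m = {l. (\<forall>i. 0 \<le> l i) \<and>
     (\<forall>i\<in>{1..<m}. l i \<le> l (Suc i) \<and> real i * l (Suc i) \<le> real (Suc i) * l i)}"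

text \<open>For \<open>i \<le> m\<close> a conversion from \<open>i\<close> to \<open>Suc m\<close>
  loses nothing by passing through \<open>m\<close>, which lets the greedy pass move surplus between
  neighbouring sizes only.\<close>

lemma scaled_exchange_Suc:
  assumes "i \<in> {1..m}"
  shows "scaled_exchange i (Suc m) = scaled_exchange i m * (real m / real (Suc m))"
  using assms by (simp add: scaled_exchange_def min_def field_simps)

text \<open>The demand met at \<open>m\<close> exceeds \<open>d m\<close> by \<open>e\<close>. The
  share \<open>th = e / (d m + e)\<close> of every contribution to size \<open>m\<close> is
  redirected to \<open>Suc m\<close>, where it is worth \<open>real m / real (Suc m)\<close> of its
  former value. The supply \<open>c\<close> of size \<open>Suc m\<close> serves its own
  size.\<close>

lemma convertible_carry_up:
  assumes conv: "convertible m s (d(m := d m + e))" and e: "0 \<le> e"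
    and d: "\<And>j. j \<in> {1..Suc m} \<Longrightarrow> 0 \<le> d j" and c: "0 \<le> c"
    and m0: "m = 0 \<Longrightarrow> e = 0"
    and s': "\<And>i. i \<in> {1..m} \<Longrightarrow> s' i = s i" "s' (Suc m) = c"
    and d': "\<And>i. i \<in> {1..m} \<Longrightarrow> d' i = d i" "d' (Suc m) = c + e * (real m / real (Suc m))"
  shows "convertible (Suc m) s' d'"
proof -
  from conv obtain r where r: "\<And>i j. i \<in> {1..m} \<Longrightarrow> j \<in> {1..m} \<Longrightarrow> 0 \<le> r i j"
    and rs: "\<And>i. i \<in> {1..m} \<Longrightarrow> (\<Sum>j=1..m. r i j) \<le> s i"
    and rd: "\<And>j. j \<in> {1..m} \<Longrightarrow> (d(m := d m + e)) j \<le> (\<Sum>i=1..m. scaled_exchange i j * r i j)"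
    unfolding convertible_def by blast
  \<comment> \<open>For \<open>e = 0\<close> nothing is moved; the denominator could then be
    zero.\<close>
  define th where "th = (if e = 0 then 0 else e / (d m + e))"
  have dm: "e \<noteq> 0 \<Longrightarrow> 0 \<le> d m" using m0 d[of m] by (cases m) auto
  have th: "0 \<le> th" "th \<le> 1" "th * (d m + e) = e"
    using e dm by (cases "e = 0"; force simp: th_def divide_simps)+
  have th': "(1 - th) * (d m + e) = d m" using th(3) by (simp add: algebra_simps)
  define r' where "r' i j = (if i \<le> m then (if j < m then r i j else if j = m then (1 - th) * r i m
      else th * r i m) else if j = Suc m then c else 0)" for i j
  have row: "(\<Sum>j=1..Suc m. r' i j) \<le> s' i" if i: "i \<in> {1..Suc m}" for i
  proof (cases "i = Suc m")
    case True then show ?thesis by (simp add: r'_def s')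
  next
    case False
    then have im: "i \<in> {1..m}" using i by auto
    then obtain m' where m': "m = Suc m'" by (cases m) auto
    have "(\<Sum>j=1..Suc m. r' i j) = (\<Sum>j=1..m'. r' i j) + (1 - th) * r i m + th * r i m"
      using im by (simp add: m' r'_def)
    also have "(\<Sum>j=1..m'. r' i j) = (\<Sum>j=1..m'. r i j)"
      using im by (intro sum.cong) (auto simp: r'_def m')
    also have "\<dots> + (1 - th) * r i m + th * r i m = (\<Sum>j=1..m. r i j)"
      by (simp add: m' algebra_simps)
    finally show ?thesis using rs[OF im] s'(1)[OF im] by simp
  qed
  have col: "d' j \<le> (\<Sum>i=1..Suc m. scaled_exchange i j * r' i j)" if j: "j \<in> {1..Suc m}" for j
  proof -
    consider "j < m" | "j = m" "1 \<le> m" | "j = Suc m" using j by fastforce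
    then show ?thesis
    proof cases
      case 1
      then have "(\<Sum>i=1..Suc m. scaled_exchange i j * r' i j) = (\<Sum>i=1..m. scaled_exchange i j * r i j)"
        by (simp add: r'_def)
      then show ?thesis using 1 j rd[of j] d' by simp
    next
      case 2
      then have "(\<Sum>i=1..Suc m. scaled_exchange i j * r' i j)
          = (1 - th) * (\<Sum>i=1..m. scaled_exchange i m * r i m)"
        by (simp add: r'_def sum_distrib_left mult_ac)
      moreover have "(1 - th) * (d m + e) \<le> (1 - th) * (\<Sum>i=1..m. scaled_exchange i m * r i m)"
        using rd[of m] 2 th by (intro mult_left_mono) auto
      ultimately show ?thesis using th' d' 2 by simp
    next
      case 3
      have "(\<Sum>i=1..Suc m. scaled_exchange i j * r' i j)
          = (\<Sum>i=1..m. scaled_exchange i (Suc m) * (th * r i m)) + c"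
        using 3 by (simp add: r'_def scaled_exchange_def)
      also have "(\<Sum>i=1..m. scaled_exchange i (Suc m) * (th * r i m))
          = th * (real m / real (Suc m)) * (\<Sum>i=1..m. scaled_exchange i m * r i m)"
        unfolding sum_distrib_left by (intro sum.cong) (auto simp: scaled_exchange_Suc)
      finally have *: "(\<Sum>i=1..Suc m. scaled_exchange i j * r' i j)
        = th * (real m / real (Suc m)) * (\<Sum>i=1..m. scaled_exchange i m * r i m) + c" .
      have "e * (real m / real (Suc m)) = th * (real m / real (Suc m)) * (d m + e)"
        using th(3) by (metis mult.assoc mult.commute)
      also have "\<dots> \<le> th * (real m / real (Suc m)) * (\<Sum>i=1..m. scaled_exchange i m * r i m)"
      proof (cases "m = 0")
        case False
        then show ?thesis using th rd[of m] by (intro mult_left_mono) auto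
      qed auto
      finally show ?thesis using * 3 d' by simp
    qed
  qed
  have "0 \<le> r' i j" if "i \<in> {1..Suc m}" "j \<in> {1..Suc m}" for i j
    using that th c r by (auto simp: r'_def)
  then show ?thesis unfolding convertible_def using row col by blast
qed

text \<open>The extra supply \<open>e\<close> at \<open>m\<close> is replaced by supply of size
  \<open>Suc m\<close>, which takes over the share \<open>th\<close> of everything that
  \<open>m\<close> contributes. No value is lost, as both sizes exchange at rate \<open>1\<close>
  into every size up to \<open>m\<close>.\<close>

lemma convertible_carry_down:
  assumes conv: "convertible m (s(m := s m + e)) d" and e: "0 < e" and m: "1 \<le> m"
    and s: "0 \<le> s m" and c: "0 \<le> c"
    and s': "\<And>i. i \<in> {1..m} \<Longrightarrow> s' i = s i" "s' (Suc m) = c + e"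
    and d': "\<And>i. i \<in> {1..m} \<Longrightarrow> d' i = d i" "d' (Suc m) = c"
  shows "convertible (Suc m) s' d'"
proof -
  from conv obtain r where r: "\<And>i j. i \<in> {1..m} \<Longrightarrow> j \<in> {1..m} \<Longrightarrow> 0 \<le> r i j"
    and rs: "\<And>i. i \<in> {1..m} \<Longrightarrow> (\<Sum>j=1..m. r i j) \<le> (s(m := s m + e)) i"
    and rd: "\<And>j. j \<in> {1..m} \<Longrightarrow> d j \<le> (\<Sum>i=1..m. scaled_exchange i j * r i j)"
    unfolding convertible_def by blast
  define th where "th = e / (s m + e)"
  have th: "0 \<le> th" "th \<le> 1" "th * (s m + e) = e" and th': "(1 - th) * (s m + e) = s m"
    using e s by (auto simp: th_def field_simps)
  define r' where "r' i j = (if j \<le> m then (if i < m then r i j else if i = m then (1 - th) * r m j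
      else th * r m j) else if i = Suc m then c else 0)" for i j
  have rsm: "(\<Sum>j=1..m. r m j) \<le> s m + e" using rs[of m] m by simp
  have row: "(\<Sum>j=1..Suc m. r' i j) \<le> s' i" if i: "i \<in> {1..Suc m}" for i
  proof -
    consider "i < m" | "i = m" | "i = Suc m" using i by fastforce
    then show ?thesis
    proof cases
      case 1
      then have "(\<Sum>j=1..Suc m. r' i j) = (\<Sum>j=1..m. r i j)" by (simp add: r'_def)
      then show ?thesis using 1 i rs[of i] s' by simp
    next
      case 2
      then have "(\<Sum>j=1..Suc m. r' i j) = (1 - th) * (\<Sum>j=1..m. r m j)"
        by (simp add: r'_def sum_distrib_left)
      also have "\<dots> \<le> (1 - th) * (s m + e)" using rsm th by (intro mult_left_mono) auto
      finally show ?thesis using th' s' 2 m by simp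
    next
      case 3
      then have "(\<Sum>j=1..Suc m. r' i j) = th * (\<Sum>j=1..m. r m j) + c"
        by (simp add: r'_def sum_distrib_left)
      also have "th * (\<Sum>j=1..m. r m j) \<le> th * (s m + e)"
        using rsm th by (intro mult_left_mono) auto
      finally show ?thesis using th s' 3 by simp
    qed
  qed
  have col: "d' j \<le> (\<Sum>i=1..Suc m. scaled_exchange i j * r' i j)" if j: "j \<in> {1..Suc m}" for j
  proof (cases "j = Suc m")
    case True
    then show ?thesis by (simp add: r'_def scaled_exchange_def d')
  next
    case False
    then have jm: "j \<in> {1..m}" using j by auto
    then obtain m' where m': "m = Suc m'" by (cases m) auto
    have one: "scaled_exchange m j = 1" "scaled_exchange (Suc m) j = 1"
      using jm by (auto simp: scaled_exchange_def min_def divide_simps)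
    have "(\<Sum>i=1..Suc m. scaled_exchange i j * r' i j)
      = (\<Sum>i=1..m'. scaled_exchange i j * r' i j) + (1 - th) * r m j + th * r m j"
      using jm one by (simp add: m' r'_def)
    also have "(\<Sum>i=1..m'. scaled_exchange i j * r' i j) = (\<Sum>i=1..m'. scaled_exchange i j * r i j)"
      using jm by (intro sum.cong) (auto simp: r'_def m')
    also have "\<dots> + (1 - th) * r m j + th * r m j = (\<Sum>i=1..m. scaled_exchange i j * r i j)"
      using one by (simp add: m' algebra_simps)
    finally show ?thesis using rd[OF jm] d' jm by simp
  qed
  have "0 \<le> r' i j" if "i \<in> {1..Suc m}" "j \<in> {1..Suc m}" for i j
    using that th c r m by (auto simp: r'_def)
  then show ?thesis unfolding convertible_def using row col by blast
qed

text \<open>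
  A greedy pass through the sizes \<open>1, 2, \<dots>\<close>: a surplus is carried from \<open>m\<close> to \<open>m + 1\<close> at the rate
  \<open>m / (m + 1)\<close>, a deficit is passed on at the rate \<open>1\<close>. The prices \<open>l\<close> record these rates.
\<close>

lemma convertible_up_to_excess:
  assumes s: "\<And>i. i \<in> {1..m} \<Longrightarrow> 0 \<le> s i" and d: "\<And>i. i \<in> {1..m} \<Longrightarrow> 0 \<le> d i"
  shows "\<exists>l\<in>price_cone m. l m = 1 \<and>
    (let e = \<Sum>i=1..m. l i * (s i - d i)
     in convertible m (s(m := s m + max 0 (- e))) (d(m := d m + max 0 e)))"
  using assms
proof (induction m)
  case 0
  then show ?case
    by (intro bexI[of _ "\<lambda>_. 1"]) (auto simp: price_cone_def convertible_def)
next
  case (Suc m)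
  have "\<exists>l\<in>price_cone m. l m = 1 \<and>
    (let e = \<Sum>i=1..m. l i * (s i - d i)
     in convertible m (s(m := s m + max 0 (- e))) (d(m := d m + max 0 e)))"
    by (rule Suc.IH) (use Suc.prems in auto)
  then obtain l where l: "l \<in> price_cone m" "l m = 1"
    and conv: "convertible m (s(m := s m + max 0 (- (\<Sum>i=1..m. l i * (s i - d i)))))
        (d(m := d m + max 0 (\<Sum>i=1..m. l i * (s i - d i))))"
    unfolding Let_def by blast
  define e where "e = (\<Sum>i=1..m. l i * (s i - d i))"
  note conv = conv[folded e_def]
  \<comment> \<open>\<open>e\<close> is the excess left over from the sizes up to \<open>m\<close>,
    negative for a deficit, and \<open>c\<close> is the rate at which it is passed on to
    \<open>Suc m\<close>. Multiplying all earlier prices by \<open>c\<close> keeps the price of the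
    last size at \<open>1\<close>.\<close>
  define c where "c = (if e \<ge> 0 then real m / real (Suc m) else 1)"
  define l' where "l' i = (if i \<le> m then c * l i else 1)" for i
  define e' where "e' = (\<Sum>i=1..Suc m. l' i * (s i - d i))"
  have c: "0 \<le> c" "c \<le> 1" "real m \<le> c * (real m + 1)" by (auto simp: c_def add.commute)
  have e': "e' = s (Suc m) - d (Suc m) + c * e"
    unfolding e'_def e_def by (simp add: l'_def sum_distrib_left mult.assoc)
  have l0: "0 \<le> l i" for i using l by (simp add: price_cone_def)
  have "l' i \<le> l' (Suc i) \<and> real i * l' (Suc i) \<le> real (Suc i) * l' i" if i: "i \<in> {1..<Suc m}" for i
  proof (cases "i = m")
    case True
    then show ?thesis using c l(2) by (simp add: l'_def mult.commute add.commute)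
  next
    case False
    then have "i \<in> {1..<m}" using i by auto
    then have "l i \<le> l (Suc i)" "real i * l (Suc i) \<le> real (Suc i) * l i" "i \<le> m" "Suc i \<le> m"
      using l unfolding price_cone_def by auto
    then show ?thesis
      using mult_left_mono[OF _ c(1), of "l i" "l (Suc i)"]
        mult_left_mono[OF _ c(1), of "real i * l (Suc i)" "real (Suc i) * l i"]
      by (simp add: l'_def mult.left_commute)
  qed
  then have cone: "l' \<in> price_cone (Suc m)"
    using c l0 by (simp add: price_cone_def l'_def)
  have "convertible (Suc m) (s(Suc m := s (Suc m) + max 0 (- e'))) (d(Suc m := d (Suc m) + max 0 e'))"
  proof (cases "e \<ge> 0")
    case True
    show ?thesis
    proof (rule convertible_carry_up[where s = s and d = d and e = e and m = m and c = "s (Suc m) + max 0 (- e')"])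
      show "convertible m s (d(m := d m + e))"
        using conv True by (simp add: max_absorb1 max_absorb2)
      show "0 \<le> s (Suc m) + max 0 (- e')" using Suc.prems(1)[of "Suc m"] by simp
      show "m = 0 \<Longrightarrow> e = 0" by (simp add: e_def)
      show "(d(Suc m := d (Suc m) + max 0 e')) (Suc m) =
        s (Suc m) + max 0 (- e') + e * (real m / real (Suc m))"
        using e' True by (simp add: c_def max_def)
    qed (use True Suc.prems in auto)
  next
    case False
    then have m: "1 \<le> m" by (cases m) (auto simp: e_def)
    show ?thesis
    \<comment> \<open>Size \<open>Suc m\<close> keeps for itself its supply minus the deficit
      \<open>- e\<close> that it covers, plus whatever is still missing and has to be added.\<close>
    proof (rule convertible_carry_down[where s = s and d = d and e = "- e" and m = m and c = "s (Suc m) + e + max 0 (- e')"])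
      show "convertible m (s(m := s m + - e)) d"
        using conv False by (simp add: max_absorb1 max_absorb2)
      show "0 \<le> s (Suc m) + e + max 0 (- e')"
        using e' False Suc.prems(2)[of "Suc m"] by (simp add: c_def max_def)
      show "(d(Suc m := d (Suc m) + max 0 e')) (Suc m) = s (Suc m) + e + max 0 (- e')"
        using e' False by (simp add: c_def max_def)
    qed (use False Suc.prems m in auto)
  qed
  moreover have "l' (Suc m) = 1" by (simp add: l'_def)
  ultimately show ?case using cone unfolding Let_def e'_def by blast
qed

lemma convertible_if_affordable:
  assumes s: "\<And>i. i \<in> {1..m} \<Longrightarrow> 0 \<le> s i" and d: "\<And>i. i \<in> {1..m} \<Longrightarrow> 0 \<le> d i"
    and aff: "\<And>l. l \<in> price_cone m \<Longrightarrow> (\<Sum>i=1..m. l i * d i) \<le> (\<Sum>i=1..m. l i * s i)"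
  shows "convertible m s d"
proof -
  have "\<exists>l\<in>price_cone m. l m = 1 \<and>
    (let e = \<Sum>i=1..m. l i * (s i - d i)
     in convertible m (s(m := s m + max 0 (- e))) (d(m := d m + max 0 e)))"
    by (rule convertible_up_to_excess) (use s d in auto)
  then obtain l where l: "l \<in> price_cone m"
    and conv: "convertible m (s(m := s m + max 0 (- (\<Sum>i=1..m. l i * (s i - d i)))))
        (d(m := d m + max 0 (\<Sum>i=1..m. l i * (s i - d i))))"
    unfolding Let_def by blast
  have "0 \<le> (\<Sum>i=1..m. l i * (s i - d i))"
    using aff[OF l] by (simp add: right_diff_distrib sum_subtractf)
  then have "convertible m s (d(m := d m + (\<Sum>i=1..m. l i * (s i - d i))))" (is "convertible m s ?d")
    using conv by (simp add: max_absorb1 max_absorb2)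
  then obtain r where r: "\<forall>i\<in>{1..m}. \<forall>j\<in>{1..m}. 0 \<le> r i j" "\<forall>i\<in>{1..m}. (\<Sum>j=1..m. r i j) \<le> s i"
    and rd: "\<forall>j\<in>{1..m}. ?d j \<le> (\<Sum>i=1..m. scaled_exchange i j * r i j)"
    unfolding convertible_def by blast
  have "d j \<le> ?d j" for j using \<open>0 \<le> _\<close> by simp
  then have "\<forall>j\<in>{1..m}. d j \<le> (\<Sum>i=1..m. scaled_exchange i j * r i j)"
    using rd order_trans by blast
  with r show ?thesis unfolding convertible_def by blast
qed

section \<open>Achievability\<close>

definition recovery_number :: "nat \<Rightarrow> nat \<Rightarrow> nat \<Rightarrow> nat" where
  "recovery_number K i j = (if i < j then (j - 1) choose (j - i) else (K - j) choose (i - j))"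

definition spread_number :: "nat \<Rightarrow> nat \<Rightarrow> nat \<Rightarrow> nat" where
  "spread_number K i j = (if i < j then (K - i) choose (j - i) else i choose (i - j))"

lemma exchange_rate_eq:
  "exchange_rate K i j = real (recovery_number K i j) / real (spread_number K i j)"
  by (auto simp: exchange_rate_def recovery_number_def spread_number_def divide_inverse)

lemma spread_number_pos:
  assumes "j \<le> K"
  shows "0 < spread_number K i j"
  using assms by (auto simp: spread_number_def)

definition comparable :: "nat set \<Rightarrow> nat set \<Rightarrow> bool" where
  "comparable A B \<longleftrightarrow> A \<subseteq> B \<or> B \<subseteq> A"

lemma card_between:
  assumes "finite T" "S \<subseteq> T" "card S \<le> n"
  shows "card {A. S \<subseteq> A \<and> A \<subseteq> T \<and> card A = n} = (card T - card S) choose (n - card S)"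
proof -
  have fS: "finite S" using assms(1,2) by (rule finite_subset[rotated])
  have "bij_betw (\<lambda>A. A \<union> S) {A. A \<subseteq> T - S \<and> card A = n - card S} {A. S \<subseteq> A \<and> A \<subseteq> T \<and> card A = n}"
  proof (rule bij_betwI[where g = "\<lambda>A. A - S"])
    show "(\<lambda>A. A \<union> S) \<in> {A. A \<subseteq> T - S \<and> card A = n - card S} \<rightarrow> {A. S \<subseteq> A \<and> A \<subseteq> T \<and> card A = n}"
    proof
      fix A assume A: "A \<in> {A. A \<subseteq> T - S \<and> card A = n - card S}"
      have "finite A" using A assms(1) by (auto intro: finite_subset)
      then have "card (A \<union> S) = card A + card S" using A fS by (intro card_Un_disjoint) auto
      then show "A \<union> S \<in> {A. S \<subseteq> A \<and> A \<subseteq> T \<and> card A = n}" using A assms by auto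
    qed
    show "(\<lambda>A. A - S) \<in> {A. S \<subseteq> A \<and> A \<subseteq> T \<and> card A = n} \<rightarrow> {A. A \<subseteq> T - S \<and> card A = n - card S}"
      using fS by (auto simp: card_Diff_subset)
  qed auto
  then have "card {A. S \<subseteq> A \<and> A \<subseteq> T \<and> card A = n} = card {A. A \<subseteq> T - S \<and> card A = n - card S}"
    by (rule bij_betw_same_card[symmetric])
  also have "\<dots> = (card T - card S) choose (n - card S)"
    using n_subsets[of "T - S" "n - card S"] assms fS by (simp add: card_Diff_subset)
  finally show ?thesis .
qed

lemma card_comparable:
  assumes A: "A \<in> receiver_sets K" and j: "j \<in> {1..K}"
  shows "card {B\<in>receiver_sets K. comparable A B \<and> card B = j} = spread_number K (card A) j"
proof (cases "card A < j")
  case True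
  note r = receiver_setsD[OF A]
  have eq: "{B\<in>receiver_sets K. comparable A B \<and> card B = j} = {B. A \<subseteq> B \<and> B \<subseteq> {1..K} \<and> card B = j}"
  proof (intro set_eqI iffI)
    fix B assume B: "B \<in> {B\<in>receiver_sets K. comparable A B \<and> card B = j}"
    then have "\<not> B \<subseteq> A" using True card_mono[OF r(1), of B] by auto
    then show "B \<in> {B. A \<subseteq> B \<and> B \<subseteq> {1..K} \<and> card B = j}"
      using B by (auto simp: comparable_def receiver_sets_def)
  qed (use A in \<open>auto simp: comparable_def receiver_sets_def\<close>)
  show ?thesis
    unfolding eq card_between[OF finite_atLeastAtMost r(2) less_imp_le[OF True]]
    using True by (simp add: spread_number_def)
next
  case False
  note r = receiver_setsD[OF A]
  have eq: "{B\<in>receiver_sets K. comparable A B \<and> card B = j} = {B. {} \<subseteq> B \<and> B \<subseteq> A \<and> card B = j}"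
  proof (intro set_eqI iffI)
    fix B assume B: "B \<in> {B\<in>receiver_sets K. comparable A B \<and> card B = j}"
    then have "finite B" using receiver_setsD(1)[of B K] by simp
    then show "B \<in> {B. {} \<subseteq> B \<and> B \<subseteq> A \<and> card B = j}"
      using B False card_seteq[of B A] by (auto simp: comparable_def)
  qed (use r j in \<open>auto simp: comparable_def receiver_sets_def\<close>)
  show ?thesis
    unfolding eq using card_between[OF r(1) empty_subsetI, of j] False binomial_symmetric[of j "card A"]
    by (simp add: spread_number_def)
qed

text \<open>Below the size of \<open>B\<close> the sets between \<open>{k}\<close> and
  \<open>B\<close> are counted, from there on the sets between \<open>B\<close> and all users. A
  lower bound is enough, as these sets supply the evaluation points seen by user
  \<open>k\<close>.\<close>

lemma card_comparable_at_user:
  assumes B: "B \<in> receiver_sets K" and k: "k \<in> B" and i: "i \<in> {1..K}"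
  shows "recovery_number K i (card B) \<le> card {A\<in>receiver_sets K. comparable A B \<and> card A = i \<and> k \<in> A}"
    (is "_ \<le> card ?S")
proof -
  note r = receiver_setsD[OF B]
  have fin: "finite ?S" by simp
  show ?thesis
  proof (cases "i < card B")
    case True
    have "card {A. {k} \<subseteq> A \<and> A \<subseteq> B \<and> card A = i} = (card B - 1) choose (i - 1)"
      using card_between[of B "{k}" i] r(1) k i by simp
    also have "\<dots> = recovery_number K i (card B)"
      using True i binomial_symmetric[of "i - 1" "card B - 1"] by (simp add: recovery_number_def)
    finally have "recovery_number K i (card B) = card {A. {k} \<subseteq> A \<and> A \<subseteq> B \<and> card A = i}" ..
    also have "\<dots> \<le> card ?S"
      using r(2) by (intro card_mono fin) (auto simp: comparable_def receiver_sets_def)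
    finally show ?thesis .
  next
    case False
    then have "recovery_number K i (card B) = card {A. B \<subseteq> A \<and> A \<subseteq> {1..K} \<and> card A = i}"
      using card_between[OF finite_atLeastAtMost r(2), of i] by (simp add: recovery_number_def)
    also have "\<dots> \<le> card ?S"
      using k by (intro card_mono fin) (auto simp: comparable_def receiver_sets_def)
    finally show ?thesis .
  qed
qed

lemma polynomial_determined:
  fixes a b :: "nat \<Rightarrow> nat"
  assumes "finite X" "d \<le> card X" and eq: "\<And>x. x \<in> X \<Longrightarrow> (\<Sum>m<d. a m * x ^ m) = (\<Sum>m<d. b m * x ^ m)"
    and m: "m < d"
  shows "a m = b m"
proof (rule ccontr)
  assume ne: "a m \<noteq> b m"
  define c where "c i = (if i < d then real (a i) - real (b i) else 0)" for i
  have le: "{..d - 1} = {..<d}" using m by auto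
  have "(\<Sum>i\<le>d - 1. c i * real x ^ i) = 0" if "x \<in> X" for x
  proof -
    have "(\<Sum>i\<le>d - 1. c i * real x ^ i) = real (\<Sum>m<d. a m * x ^ m) - real (\<Sum>m<d. b m * x ^ m)"
      unfolding le by (simp add: c_def left_diff_distrib sum_subtractf)
    then show ?thesis using eq[OF that] by simp
  qed
  then have sub: "real ` X \<subseteq> {z. (\<Sum>i\<le>d - 1. c i * z ^ i) = 0}" by auto
  have "c m \<noteq> 0" using ne m by (simp add: c_def)
  then have "finite {z. (\<Sum>i\<le>d - 1. c i * z ^ i) = 0} \<and> card {z. (\<Sum>i\<le>d - 1. c i * z ^ i) = 0} \<le> d - 1"
    using m by (intro Transcendental.polyfun_rootbound[where k = m and c = c]) auto
  moreover have "card X = card (real ` X)" by (simp add: card_image)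
  ultimately have "card X \<le> d - 1" using card_mono[OF _ sub] by linarith
  then show False using assms(2) m by linarith
qed

text \<open>Stated as a separation property without decoders: a decoder is obtained later by
  choosing any preimage.\<close>

definition determines_messages ::
    "nat \<Rightarrow> nat \<Rightarrow> (nat \<Rightarrow> real) \<Rightarrow> ((nat set \<Rightarrow> nat) \<Rightarrow> (nat set \<Rightarrow> nat)) \<Rightarrow> bool" where
  "determines_messages K n R h \<longleftrightarrow>
     (\<forall>k\<in>{1..K}. \<forall>w\<in>Pi\<^sub>E (receiver_sets K) (message_set n R). \<forall>w'\<in>Pi\<^sub>E (receiver_sets K) (message_set n R).
        (\<forall>A\<in>receiver_sets K. k \<in> A \<longrightarrow> h w A = h w' A) \<longrightarrow>
        (\<forall>B\<in>receiver_sets K. k \<in> B \<longrightarrow> w B = w' B))"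

lemma finite_message_set [simp]: "finite (message_set n R A)"
  by (simp add: message_set_def)

lemma card_message_set: "card (message_set n R A) = nat \<lfloor>2 powr (real n * R (card A))\<rfloor>"
  by (simp add: message_set_def)

text \<open>
  Message \<open>B\<close> is cut, for each \<open>i\<close>, into the \<open>recovery_number K i (card B)\<close> coefficients of a
  polynomial; the message on \<open>A\<close> carries the values of these polynomials at a point attached to \<open>A\<close>,
  one for each \<open>B\<close> comparable to \<open>A\<close>.
\<close>

lemma exists_exchange_map:
  fixes P :: "nat \<Rightarrow> nat \<Rightarrow> nat"
  assumes P: "\<And>i j. 1 \<le> P i j"
    and big: "\<And>A B. A \<in> receiver_sets K \<Longrightarrow> B \<in> receiver_sets K \<Longrightarrow>
        (\<Sum>m<recovery_number K (card A) (card B). x A ^ m) \<le> C"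
    and inj: "inj_on x (receiver_sets K)"
    and carry: "\<And>A. A \<in> receiver_sets K \<Longrightarrow>
        (\<Prod>B\<in>{B\<in>receiver_sets K. comparable A B}. C * (P (card A) (card B) - 1) + 1) \<le> card (message_set n R A)"
    and cut: "\<And>B. B \<in> receiver_sets K \<Longrightarrow>
        card (message_set n R' B) \<le> (\<Prod>i=1..K. P i (card B) ^ recovery_number K i (card B))"
  shows "\<exists>h \<in> Pi\<^sub>E (receiver_sets K) (message_set n R') \<rightarrow> Pi\<^sub>E (receiver_sets K) (message_set n R).
           determines_messages K n R' h"
proof -
  let ?d = "\<lambda>i B. recovery_number K i (card B)"
  let ?I = "\<lambda>B. SIGMA i:{1..K}. {..<?d i B}"
  let ?V = "\<lambda>B. Pi\<^sub>E (?I B) (\<lambda>(i, m). {..<P i (card B)})"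
  let ?N = "\<lambda>A. {B\<in>receiver_sets K. comparable A B}"
  let ?S = "\<lambda>A. Pi\<^sub>E (?N A) (\<lambda>B. {..C * (P (card A) (card B) - 1)})"
  have finV: "finite (?V B)" for B by (intro finite_PiE) auto
  have finS: "finite (?S A)" for A by (intro finite_PiE) auto
  have cardV: "card (?V B) = (\<Prod>i=1..K. P i (card B) ^ ?d i B)" for B
  proof -
    have cardV: "card (?V B) = (\<Prod>im\<in>?I B. card ((\<lambda>(i, m). {..<P i (card B)}) im))"
      by (rule card_PiE) auto
    also have "\<dots> = (\<Prod>(i, m)\<in>?I B. P i (card B))"
      by (intro prod.cong) auto
    also have "\<dots> = (\<Prod>i=1..K. \<Prod>m<?d i B. P i (card B))"
      by (subst prod.Sigma) auto
    finally show ?thesis by simp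
  qed
  \<comment> \<open>Counting alone provides the encodings: \<open>a B\<close> writes a new message
    as an array of coefficients, and \<open>b A\<close> below packs a tuple of values into a message
    of the old code.\<close>
  have "\<exists>a. \<forall>B\<in>receiver_sets K. a B ` message_set n R' B \<subseteq> ?V B \<and> inj_on (a B) (message_set n R' B)"
    by (intro bchoice ballI card_le_inj finite_message_set finV) (simp only: cardV cut)
  then obtain a where a: "\<And>B. B \<in> receiver_sets K \<Longrightarrow> a B ` message_set n R' B \<subseteq> ?V B"
      "\<And>B. B \<in> receiver_sets K \<Longrightarrow> inj_on (a B) (message_set n R' B)"
    by blast
  have cardS: "card (?S A) = (\<Prod>B\<in>?N A. C * (P (card A) (card B) - 1) + 1)" for A
    by (subst card_PiE) auto
  have "\<exists>b. \<forall>A\<in>receiver_sets K. b A ` ?S A \<subseteq> message_set n R A \<and> inj_on (b A) (?S A)"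
    by (intro bchoice ballI card_le_inj finite_message_set finS) (simp only: cardS carry)
  then obtain b where b: "\<And>A. A \<in> receiver_sets K \<Longrightarrow> b A ` ?S A \<subseteq> message_set n R A"
      "\<And>A. A \<in> receiver_sets K \<Longrightarrow> inj_on (b A) (?S A)"
    by blast
  define s where "s w A = (\<lambda>B\<in>?N A. \<Sum>m<?d (card A) B. a B (w B) (card A, m) * x A ^ m)"
    for w :: "nat set \<Rightarrow> nat" and A
  define h where "h w = (\<lambda>A\<in>receiver_sets K. b A (s w A))" for w
  have s: "s w A \<in> ?S A" if w: "w \<in> Pi\<^sub>E (receiver_sets K) (message_set n R')" and A: "A \<in> receiver_sets K" for w A
  proof -
    have "(\<Sum>m<?d (card A) B. a B (w B) (card A, m) * x A ^ m) \<le> C * (P (card A) (card B) - 1)"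
      if B: "B \<in> ?N A" for B
    proof -
      have "w B \<in> message_set n R' B" using w B by auto
      then have V: "a B (w B) \<in> ?V B" using a(1)[of B] B by auto
      have "a B (w B) (card A, m) \<le> P (card A) (card B) - 1" if "m < ?d (card A) B" for m
      proof -
        have "(card A, m) \<in> ?I B" using that receiver_setsD(3,4)[OF A] by simp
        from PiE_mem[OF V this] show ?thesis by auto
      qed
      then have "(\<Sum>m<?d (card A) B. a B (w B) (card A, m) * x A ^ m)
          \<le> (\<Sum>m<?d (card A) B. (P (card A) (card B) - 1) * x A ^ m)"
        by (intro sum_mono mult_right_mono) auto
      also have "\<dots> = (P (card A) (card B) - 1) * (\<Sum>m<?d (card A) B. x A ^ m)"
        by (simp only: sum_distrib_left)
      also have "\<dots> \<le> (P (card A) (card B) - 1) * C"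
        using big[OF A, of B] B by (intro mult_left_mono) auto
      finally show ?thesis by (simp only: mult.commute)
    qed
    then show ?thesis unfolding s_def by (auto simp: PiE_iff)
  qed
  have h: "h \<in> Pi\<^sub>E (receiver_sets K) (message_set n R') \<rightarrow> Pi\<^sub>E (receiver_sets K) (message_set n R)"
    unfolding h_def using s b(1) by (auto simp: PiE_iff image_subset_iff)
  have dec: "w B = w' B" if k: "k \<in> {1..K}"
    and w: "w \<in> Pi\<^sub>E (receiver_sets K) (message_set n R')" and w': "w' \<in> Pi\<^sub>E (receiver_sets K) (message_set n R')"
    and eq: "\<forall>A\<in>receiver_sets K. k \<in> A \<longrightarrow> h w A = h w' A"
    and B: "B \<in> receiver_sets K" "k \<in> B" for k w w' B
  proof -
    have wB: "w B \<in> message_set n R' B" "w' B \<in> message_set n R' B" using w w' B by auto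
    have V: "a B (w B) \<in> ?V B" "a B (w' B) \<in> ?V B" using a(1)[OF B(1)] wB by auto
    have "a B (w B) (i, m) = a B (w' B) (i, m)" if im: "(i, m) \<in> ?I B" for i m
    \<comment> \<open>The sets of size \<open>i\<close> that contain \<open>k\<close> and are
      comparable to \<open>B\<close> evaluate the same polynomial at distinct points, and user
      \<open>k\<close> knows all these values.\<close>
    proof (rule polynomial_determined[where a = "\<lambda>m. a B (w B) (i, m)" and b = "\<lambda>m. a B (w' B) (i, m)"])
      let ?X = "{A\<in>receiver_sets K. comparable A B \<and> card A = i \<and> k \<in> A}"
      show "finite (x ` ?X)" by simp
      have "inj_on x ?X" using inj by (rule inj_on_subset) auto
      then show "?d i B \<le> card (x ` ?X)"
        using card_comparable_at_user[OF B, of i] im by (simp add: card_image)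
      show "m < ?d i B" using im by simp
      fix y assume "y \<in> x ` ?X"
      then obtain A where A: "A \<in> receiver_sets K" "comparable A B" "card A = i" "k \<in> A" "y = x A" by auto
      have "b A (s w A) = b A (s w' A)" using eq A unfolding h_def by auto
      then have "s w A = s w' A" using b(2)[OF A(1)] s[OF w A(1)] s[OF w' A(1)] by (auto dest: inj_onD)
      then have "s w A B = s w' A B" by simp
      then show "(\<Sum>m<?d i B. a B (w B) (i, m) * y ^ m) = (\<Sum>m<?d i B. a B (w' B) (i, m) * y ^ m)"
        unfolding s_def using A B by simp
    qed
    then have "a B (w B) = a B (w' B)"
      using V by (intro PiE_ext[where k = "?I B"]) auto
    then show ?thesis using a(2)[OF B(1)] wB by (auto dest: inj_onD)
  qed
  show ?thesis
    by (rule bexI[OF _ h], unfold determines_messages_def, intro ballI impI) (rule dec; assumption)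
qed

section \<open>Uniform messages, error probabilities and recoding\<close>

lemma one_le_card_message_set:
  assumes "R \<in> {1..K} \<rightarrow>\<^sub>E {0..}" "A \<in> receiver_sets K"
  shows "1 \<le> card (message_set n R A)"
proof -
  have "0 \<le> R (card A)" using assms receiver_setsD(3,4)[of A K] by (auto simp: PiE_iff)
  then have "1 \<le> (2::real) powr (real n * R (card A))" by (intro ge_one_powr_ge_zero) auto
  then have "1 \<le> \<lfloor>(2::real) powr (real n * R (card A))\<rfloor>" by simp
  then show ?thesis unfolding card_message_set by linarith
qed

lemma messages_ne:
  assumes "R \<in> {1..K} \<rightarrow>\<^sub>E {0..}"
  shows "Pi\<^sub>E (receiver_sets K) (message_set n R) \<noteq> {}"
proof -
  have "message_set n R A \<noteq> {}" if "A \<in> receiver_sets K" for A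
    using one_le_card_message_set[OF assms that, of n] by auto
  then show ?thesis by (simp add: PiE_eq_empty_iff)
qed

lemma finite_messages [simp]: "finite (Pi\<^sub>E (receiver_sets K) (message_set n R))"
  by (intro finite_PiE) auto

abbreviation error_event where
  "error_event K p n g w \<equiv> {y \<in> space (output_space K p {..<n}).
      \<exists>k\<in>{1..K}. \<exists>A\<in>receiver_sets K. k \<in> A \<and> w A \<noteq> g k (y k) A}"

lemma error_probability_eq:
  assumes R: "R \<in> {1..K} \<rightarrow>\<^sub>E {0..}"
  shows "error_probability K p n R f g =
    (\<Sum>w\<in>Pi\<^sub>E (receiver_sets K) (message_set n R). measure (block_law K p n (f w)) (error_event K p n g w))
      / real (card (Pi\<^sub>E (receiver_sets K) (message_set n R)))"
proof -
  have ne: "message_set n R A \<noteq> {}" if "A \<in> receiver_sets K" for A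
    using one_le_card_message_set[OF R that, of n] by auto
  have dflt: "PiE_dflt (receiver_sets K) undefined (message_set n R) = Pi\<^sub>E (receiver_sets K) (message_set n R)"
    by (auto simp: PiE_dflt_def PiE_def extensional_def)
  have "message_pmf K n R = pmf_of_set (Pi\<^sub>E (receiver_sets K) (message_set n R))"
    unfolding message_pmf_def dflt[symmetric] using ne by (intro Pi_pmf_of_set) auto
  then show ?thesis
    unfolding error_probability_def by (simp add: integral_pmf_of_set messages_ne[OF R])
qed

lemma extend_input:
  assumes p: "is_broadcast_channel K p" and x: "x \<in> space (input_space p {..<n})"
  shows "(\<lambda>t. if t < n then x t else (SOME a. a \<in> space (input_alphabet p))) \<in> space (input_space p UNIV)"
proof -
  have "(SOME a. a \<in> space (input_alphabet p)) \<in> space (input_alphabet p)"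
    using p unfolding is_broadcast_channel_def by (simp add: some_in_eq)
  then show ?thesis using x by (auto simp: input_space_def space_PiM PiE_iff)
qed

lemma prob_space_first_outputs_law:
  assumes p: "is_broadcast_channel K p" and x: "x \<in> space (input_space p UNIV)"
  shows "prob_space (first_outputs_law K p n x)"
    and "sets (first_outputs_law K p n x) = sets (output_space K p {..<n})"
proof -
  have "channel_law p x \<in> space (prob_algebra (output_space K p UNIV))"
    using p x measurable_space[of "channel_law p"] unfolding is_broadcast_channel_def by metis
  then have law: "prob_space (channel_law p x)" "sets (channel_law p x) = sets (output_space K p UNIV)"
    by (auto simp: space_prob_algebra)
  have "first_outputs K n \<in> channel_law p x \<rightarrow>\<^sub>M output_space K p {..<n}"
    using first_outputs_measurable by (simp add: measurable_cong_sets[OF law(2) refl])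
  then show "prob_space (first_outputs_law K p n x)"
    unfolding first_outputs_law_def by (rule prob_space.prob_space_distr[OF law(1)])
  show "sets (first_outputs_law K p n x) = sets (output_space K p {..<n})"
    by (simp add: first_outputs_law_def)
qed

lemma prob_space_block_law:
  assumes p: "is_broadcast_channel K p" and x: "x \<in> space (input_space p {..<n})"
  shows "prob_space (block_law K p n x)" "sets (block_law K p n x) = sets (output_space K p {..<n})"
  unfolding block_law_def by (rule prob_space_first_outputs_law[OF p extend_input[OF p x]])+

lemma add_mod_cancel_nat:
  fixes a x y m :: nat
  assumes "x \<in> {1..m}" "y \<in> {1..m}" "(a + x) mod m = (a + y) mod m"
  shows "x = y"
proof -
  have *: "x = y" if "x \<in> {1..m}" "y \<in> {1..m}" "(a + x) mod m = (a + y) mod m" "x \<le> y" for x y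
  proof -
    have "m dvd (a + y) - (a + x)"
      using that(3,4) mod_eq_dvd_iff_nat[of "a + x" "a + y" m] by simp
    moreover have "y - x < m" using that(1,2) by auto
    ultimately have "y - x = 0" by (auto dest: dvd_imp_le)
    then show ?thesis using that(4) by simp
  qed
  show ?thesis using *[of x y] *[of y x] assms by (cases "x \<le> y") auto
qed

text \<open>
  The messages \<open>h w\<close> are not uniformly distributed. They become so after adding a uniformly
  distributed shift \<open>z\<close>, and some value of \<open>z\<close> is at least as good as the average over all shifts.
\<close>

lemma exists_recoded:
  fixes p :: "('a, 'b) channel"
  assumes p: "is_broadcast_channel K p"
    and R: "R \<in> {1..K} \<rightarrow>\<^sub>E {0..}" and R': "R' \<in> {1..K} \<rightarrow>\<^sub>E {0..}"
    and code: "is_code K p n R f g"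
    and h: "h \<in> Pi\<^sub>E (receiver_sets K) (message_set n R') \<rightarrow> Pi\<^sub>E (receiver_sets K) (message_set n R)"
    and det: "determines_messages K n R' h"
  shows "\<exists>f' g'. is_code K p n R' f' g' \<and> error_probability K p n R' f' g' \<le> error_probability K p n R f g"
proof -
  let ?O = "Pi\<^sub>E (receiver_sets K) (message_set n R)"
  let ?N = "Pi\<^sub>E (receiver_sets K) (message_set n R')"
  let ?at = "\<lambda>k. {A\<in>receiver_sets K. k \<in> A}"
  define M where "M A = card (message_set n R A)" for A
  have M: "message_set n R A = {1..M A}" for A by (simp add: M_def message_set_def)
  have M_pos: "1 \<le> M A" if "A \<in> receiver_sets K" for A
    unfolding M_def by (rule one_le_card_message_set[OF R that])
  \<comment> \<open>Messages start at \<open>1\<close>, so \<open>1\<close> is added to the residue.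
    The definition is symmetric in \<open>z\<close> and \<open>v\<close>, so that bijectivity in the
    shift follows from cancellation in the message.\<close>
  define shift where "shift z v = (\<lambda>A\<in>receiver_sets K. (v A + z A) mod M A + 1)" for z v :: "nat set \<Rightarrow> nat"
  have shift: "shift z v \<in> ?O" for z v
    unfolding shift_def M using M_pos by (auto simp: PiE_iff Suc_le_eq)
  have shift_cancel: "v A = v' A"
    if "v \<in> ?O" "v' \<in> ?O" "A \<in> receiver_sets K" "shift z v A = shift z v' A" for z v v' A
  proof (rule add_mod_cancel_nat)
    show "v A \<in> {1..M A}" "v' A \<in> {1..M A}" using that(1-3) M by blast+
    show "(z A + v A) mod M A = (z A + v' A) mod M A"
      using that(3,4) by (simp add: shift_def add.commute)
  qed
  have shift_commute: "shift z v = shift v z" for z v by (simp add: shift_def add.commute)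
  have bij: "bij_betw (\<lambda>z. shift z v) ?O ?O" for v
  proof -
    have "inj_on (\<lambda>z. shift z v) ?O"
    proof (rule inj_onI)
      fix z z' assume z: "z \<in> ?O" "z' \<in> ?O" "shift z v = shift z' v"
      then have "z A = z' A" if "A \<in> receiver_sets K" for A
        using shift_cancel[of z z' A v] that by (simp add: shift_commute[of v])
      then show "z = z'" using z by (intro PiE_ext[where k = "receiver_sets K"]) auto
    qed
    moreover have "(\<lambda>z. shift z v) ` ?O \<subseteq> ?O" using shift by auto
    ultimately show ?thesis
      using endo_inj_surj[OF finite_messages] by (auto simp: bij_betw_def)
  qed
  define e where "e w = measure (block_law K p n (f w)) (error_event K p n g w)" for w
  define avg where "avg = (\<Sum>w\<in>?O. e w) / real (card ?O)"
  have cO: "0 < real (card ?O)" using messages_ne[OF R] by (simp add: card_gt_0_iff)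
  have cN: "0 < real (card ?N)" using messages_ne[OF R'] by (simp add: card_gt_0_iff)
  have "\<exists>z\<in>?O. (\<Sum>w\<in>?N. e (shift z (h w))) \<le> real (card ?N) * avg"
  proof (rule ccontr)
    assume "\<not> ?thesis"
    then have "(\<Sum>z\<in>?O. real (card ?N) * avg) < (\<Sum>z\<in>?O. \<Sum>w\<in>?N. e (shift z (h w)))"
      using messages_ne[OF R] by (intro sum_strict_mono) auto
    also have "\<dots> = (\<Sum>w\<in>?N. \<Sum>z\<in>?O. e (shift z (h w)))" by (rule sum.swap)
    also have "\<dots> = (\<Sum>w\<in>?N. \<Sum>v\<in>?O. e v)"
      by (intro sum.cong refl sum.reindex_bij_betw bij)
    also have "\<dots> = (\<Sum>z\<in>?O. real (card ?N) * avg)"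
      using cO by (simp add: avg_def)
    finally show False by simp
  qed
  then obtain z where z: "(\<Sum>w\<in>?N. e (shift z (h w))) \<le> real (card ?N) * avg" by blast
  define f' where "f' w = f (shift z (h w))" for w
  define consistent where "consistent k v w \<longleftrightarrow> w \<in> ?N \<and> (\<forall>A\<in>?at k. shift z (h w) A = v A)" for k v w
  \<comment> \<open>The decoder picks any new message tuple compatible with the old messages decoded
    at \<open>k\<close>. If there is none, the old code has erred, and an arbitrary tuple keeps the
    output in range.\<close>
  define D where "D k v = restrict (if Ex (consistent k v) then Eps (consistent k v) else (SOME w. w \<in> ?N)) (?at k)" for k v
  define g' where "g' k y = D k (g k y)" for k y
  have D: "D k v \<in> Pi\<^sub>E (?at k) (message_set n R')" for k v
  proof -
    have "(if Ex (consistent k v) then Eps (consistent k v) else (SOME w. w \<in> ?N)) \<in> ?N"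
    proof (cases "Ex (consistent k v)")
      case True
      then show ?thesis using someI_ex[OF True] by (simp add: consistent_def[of k v "Eps _"])
    next
      case False
      show ?thesis unfolding if_not_P[OF False] some_in_eq by (rule messages_ne[OF R'])
    qed
    then show ?thesis unfolding D_def by (auto simp: PiE_iff)
  qed
  have f: "f \<in> ?O \<rightarrow> space (input_space p {..<n})" using code by (simp add: is_code_def)
  have "g' k \<in> user_space p {..<n} k \<rightarrow>\<^sub>M count_space (Pi\<^sub>E (?at k) (message_set n R'))"
    if k: "k \<in> {1..K}" for k
  proof -
    have "g k \<in> user_space p {..<n} k \<rightarrow>\<^sub>M count_space (Pi\<^sub>E (?at k) (message_set n R))"
      using code k by (simp add: is_code_def)
    moreover have "D k \<in> count_space (Pi\<^sub>E (?at k) (message_set n R)) \<rightarrow>\<^sub>M count_space (Pi\<^sub>E (?at k) (message_set n R'))"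
      using D by simp
    ultimately show ?thesis unfolding g'_def by (rule measurable_compose)
  qed
  then have code': "is_code K p n R' f' g'"
    unfolding is_code_def f'_def using Pi_mem[OF f shift] by blast
  have "measure (block_law K p n (f' w)) (error_event K p n g' w) \<le> e (shift z (h w))" if w: "w \<in> ?N" for w
  proof -
    have fw: "f' w \<in> space (input_space p {..<n})" unfolding f'_def by (rule Pi_mem[OF f shift])
    interpret prob_space "block_law K p n (f' w)" by (rule prob_space_block_law(1)[OF p fw])
    have "error_event K p n g' w \<subseteq> error_event K p n g (shift z (h w))"
    proof (rule ccontr)
      assume "\<not> ?thesis"
      then obtain y k A where y: "y \<in> space (output_space K p {..<n})" and k: "k \<in> {1..K}"
        and A: "A \<in> receiver_sets K" "k \<in> A" "w A \<noteq> g' k (y k) A"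
        and ok: "\<forall>k\<in>{1..K}. \<forall>A\<in>receiver_sets K. k \<in> A \<longrightarrow> shift z (h w) A = g k (y k) A"
        by blast
      define w' where "w' = Eps (consistent k (g k (y k)))"
      have c: "consistent k (g k (y k)) w" using w ok k by (auto simp: consistent_def)
      then have c': "consistent k (g k (y k)) w'" unfolding w'_def by (rule someI[of "consistent k (g k (y k))"])
      have w': "w' \<in> ?N" using c' by (simp add: consistent_def)
      have "h w B = h w' B" if B: "B \<in> receiver_sets K" "k \<in> B" for B
      proof (rule shift_cancel[where z = z])
        show "h w \<in> ?O" "h w' \<in> ?O" using h w w' by blast+
        show "shift z (h w) B = shift z (h w') B" using c c' B by (simp add: consistent_def)
      qed (use B in auto)
      then have "w A = w' A" using det k w w' A unfolding determines_messages_def by blast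
      moreover have "g' k (y k) A = w' A"
        using c A unfolding g'_def D_def w'_def by auto
      ultimately show False using A by simp
    qed
    then show ?thesis
      unfolding e_def f'_def[symmetric]
      by (rule finite_measure_mono) (simp only: prob_space_block_law(2)[OF p fw] error_event_measurable[OF code])
  qed
  then have "(\<Sum>w\<in>?N. measure (block_law K p n (f' w)) (error_event K p n g' w)) \<le> (\<Sum>w\<in>?N. e (shift z (h w)))"
    by (rule sum_mono)
  then have "error_probability K p n R' f' g' \<le> error_probability K p n R f g"
    unfolding error_probability_eq[OF R] error_probability_eq[OF R'] using z cN
    by (simp add: avg_def e_def divide_le_eq mult.commute)
  then show ?thesis using code' by blast
qed

text \<open>Achievability asks for a code at every block length; this one serves the lengths at
  which no exchange map is available.\<close>

lemma exists_code:
  fixes p :: "('a, 'b) channel"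
  assumes p: "is_broadcast_channel K p" and R: "R \<in> {1..K} \<rightarrow>\<^sub>E {0..}"
  shows "\<exists>f g. is_code K p n R f g"
proof -
  obtain a where a: "a \<in> space (input_alphabet p)"
    using p unfolding is_broadcast_channel_def by blast
  obtain w where w: "w \<in> Pi\<^sub>E (receiver_sets K) (message_set n R)"
    using messages_ne[OF R] by blast
  have "restrict (\<lambda>_. a) {..<n} \<in> space (input_space p {..<n})"
    using a by (auto simp: input_space_def space_PiM)
  moreover have "restrict w {A\<in>receiver_sets K. k \<in> A} \<in> (\<Pi>\<^sub>E A\<in>{A\<in>receiver_sets K. k \<in> A}. message_set n R A)" for k
    using w by (auto simp: PiE_iff)
  ultimately have "is_code K p n R (\<lambda>_. restrict (\<lambda>_. a) {..<n}) (\<lambda>k _. restrict w {A\<in>receiver_sets K. k \<in> A})"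
    unfolding is_code_def by auto
  then show ?thesis by blast
qed

lemma symmetrically_achievable_recoded:
  fixes p :: "('a, 'b) channel"
  assumes p: "is_broadcast_channel K p" and R': "R' \<in> {1..K} \<rightarrow>\<^sub>E {0..}"
    and ach: "symmetrically_achievable K p R"
    and ev: "\<forall>\<^sub>F n in sequentially. \<exists>h \<in> Pi\<^sub>E (receiver_sets K) (message_set n R') \<rightarrow> Pi\<^sub>E (receiver_sets K) (message_set n R).
           determines_messages K n R' h"
  shows "symmetrically_achievable K p R'"
proof -
  from ach obtain f g where R: "R \<in> {1..K} \<rightarrow>\<^sub>E {0..}" and code: "\<And>n. is_code K p n R (f n) (g n)"
    and lim: "(\<lambda>n. error_probability K p n R (f n) (g n)) \<longlonglongrightarrow> 0"
    unfolding symmetrically_achievable_def by blast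
  let ?h = "\<lambda>n. \<exists>h \<in> Pi\<^sub>E (receiver_sets K) (message_set n R') \<rightarrow> Pi\<^sub>E (receiver_sets K) (message_set n R).
           determines_messages K n R' h"
  have "\<exists>f' g'. is_code K p n R' f' g' \<and>
    (?h n \<longrightarrow> error_probability K p n R' f' g' \<le> error_probability K p n R (f n) (g n))" for n
    using exists_recoded[OF p R R' code] exists_code[OF p R'] by meson
  then obtain f' g' where code': "\<And>n. is_code K p n R' (f' n) (g' n)"
    and le: "\<And>n. ?h n \<Longrightarrow> error_probability K p n R' (f' n) (g' n) \<le> error_probability K p n R (f n) (g n)"
    by metis
  have "(\<lambda>n. error_probability K p n R' (f' n) (g' n)) \<longlonglongrightarrow> 0"
  proof (rule tendsto_sandwich[OF _ _ tendsto_const lim])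
    show "\<forall>\<^sub>F n in sequentially. 0 \<le> error_probability K p n R' (f' n) (g' n)"
      unfolding error_probability_eq[OF R'] by (auto intro!: always_eventually divide_nonneg_nonneg sum_nonneg)
    show "\<forall>\<^sub>F n in sequentially. error_probability K p n R' (f' n) (g' n) \<le> error_probability K p n R (f n) (g n)"
      using ev by eventually_elim (rule le)
  qed
  then show ?thesis unfolding symmetrically_achievable_def using R' code' by blast
qed

lemma mem_capacity_region_iff:
  "R \<in> capacity_region K p \<longleftrightarrow> R \<in> extensional {1..K} \<and>
     (\<forall>e>0. \<exists>R'. symmetrically_achievable K p R' \<and> (\<forall>i\<in>{1..K}. \<bar>R' i - R i\<bar> < e))"
proof -
  let ?X = "product_topology (\<lambda>_. euclideanreal) {1..K}"
  have top: "topspace ?X = extensional {1..K}" by (simp add: PiE_def)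
  have "(\<forall>T. R \<in> T \<and> openin ?X T \<longrightarrow> (\<exists>R'. R' \<in> {R. symmetrically_achievable K p R} \<and> R' \<in> T)) \<longleftrightarrow>
     (\<forall>e>0. \<exists>R'. symmetrically_achievable K p R' \<and> (\<forall>i\<in>{1..K}. \<bar>R' i - R i\<bar> < e))"
    if ext: "R \<in> extensional {1..K}"
  proof (intro iffI allI impI)
    fix e :: real assume e: "0 < e"
      and cl: "\<forall>T. R \<in> T \<and> openin ?X T \<longrightarrow> (\<exists>R'. R' \<in> {R. symmetrically_achievable K p R} \<and> R' \<in> T)"
    let ?T = "Pi\<^sub>E {1..K} (\<lambda>i. ball (R i) e)"
    have "openin ?X ?T" unfolding openin_PiE_gen by auto
    moreover have "R \<in> ?T" using ext e by (auto simp: PiE_iff)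
    ultimately obtain R' where "symmetrically_achievable K p R'" "R' \<in> ?T" using cl by blast
    then show "\<exists>R'. symmetrically_achievable K p R' \<and> (\<forall>i\<in>{1..K}. \<bar>R' i - R i\<bar> < e)"
      by (intro exI[of _ R']) (auto simp: PiE_iff dist_real_def abs_minus_commute)
  next
    fix T assume T: "R \<in> T \<and> openin ?X T"
      and ap: "\<forall>e>0. \<exists>R'. symmetrically_achievable K p R' \<and> (\<forall>i\<in>{1..K}. \<bar>R' i - R i\<bar> < e)"
    then obtain U where U: "\<forall>i\<in>{1..K}. openin euclideanreal (U i)" "R \<in> Pi\<^sub>E {1..K} U" "Pi\<^sub>E {1..K} U \<subseteq> T"
      unfolding openin_product_topology_alt by blast
    have "\<forall>i\<in>{1..K}. \<exists>e. 0 < e \<and> ball (R i) e \<subseteq> U i"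
      using U by (auto simp: open_contains_ball PiE_iff)
    from bchoice[OF this] obtain e where e: "\<And>i. i \<in> {1..K} \<Longrightarrow> 0 < e i \<and> ball (R i) (e i) \<subseteq> U i"
      by blast
    define e0 where "e0 = Min (insert 1 (e ` {1..K}))"
    have "0 < e0" unfolding e0_def using e by (subst Min_gr_iff) auto
    then obtain R' where R': "symmetrically_achievable K p R'" "\<forall>i\<in>{1..K}. \<bar>R' i - R i\<bar> < e0"
      using ap by blast
    have "R' i \<in> U i" if i: "i \<in> {1..K}" for i
    proof -
      have "e0 \<le> e i" unfolding e0_def using i by (intro Min_le) auto
      then have "R' i \<in> ball (R i) (e i)" using R' i by (force simp: dist_real_def abs_minus_commute)
      then show ?thesis using e[OF i] by blast
    qed
    moreover have "R' \<in> extensional {1..K}"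
      using R'(1) by (auto simp: symmetrically_achievable_def PiE_def)
    ultimately have "R' \<in> Pi\<^sub>E {1..K} U" by (simp add: PiE_iff)
    then have "R' \<in> T" using U(3) by blast
    then show "\<exists>R'. R' \<in> {R. symmetrically_achievable K p R} \<and> R' \<in> T" using R' by blast
  qed
  then show ?thesis
    unfolding capacity_region_def in_closure_of top by blast
qed

text \<open>Rounding down costs at most one bit, because a floor that is at least \<open>1\<close>
  exceeds half of its argument.\<close>

lemma floor_powr_bounds:
  assumes "0 \<le> a"
  shows "1 \<le> nat \<lfloor>2 powr a\<rfloor>" "real (nat \<lfloor>2 powr a\<rfloor>) \<le> 2 powr a" "2 powr a / 2 \<le> real (nat \<lfloor>2 powr a\<rfloor>)"
proof -
  have one: "1 \<le> (2::real) powr a" using assms by (intro ge_one_powr_ge_zero) auto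
  then have "1 \<le> \<lfloor>(2::real) powr a\<rfloor>" by simp
  then have *: "real (nat \<lfloor>2 powr a\<rfloor>) = of_int \<lfloor>2 powr a\<rfloor>" "1 \<le> real_of_int \<lfloor>2 powr a\<rfloor>" by auto
  show "1 \<le> nat \<lfloor>2 powr a\<rfloor>" using \<open>1 \<le> \<lfloor>_\<rfloor>\<close> by linarith
  show "real (nat \<lfloor>2 powr a\<rfloor>) \<le> 2 powr a" unfolding * by linarith
  show "2 powr a / 2 \<le> real (nat \<lfloor>2 powr a\<rfloor>)"
    unfolding *(1) using *(2) real_of_int_floor_add_one_gt[of "2 powr a"] by linarith
qed

lemma sum_comparable:
  fixes u :: "nat \<Rightarrow> real"
  assumes A: "A \<in> receiver_sets K"
  shows "(\<Sum>B\<in>{B\<in>receiver_sets K. comparable A B}. u (card B)) = (\<Sum>j=1..K. real (spread_number K (card A) j) * u j)"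
proof -
  let ?N = "{B\<in>receiver_sets K. comparable A B}"
  have "(\<Sum>B\<in>?N. u (card B)) = (\<Sum>j=1..K. \<Sum>B\<in>{B\<in>?N. card B = j}. u (card B))"
    using receiver_setsD(3,4) by (intro sum.group[symmetric]) auto
  also have "\<dots> = (\<Sum>j=1..K. real (spread_number K (card A) j) * u j)"
  proof (intro sum.cong refl)
    fix j assume j: "j \<in> {1..K}"
    have "{B\<in>?N. card B = j} = {B\<in>receiver_sets K. comparable A B \<and> card B = j}" by auto
    then have "card {B\<in>?N. card B = j} = spread_number K (card A) j"
      using card_comparable[OF A j] by simp
    then show "(\<Sum>B\<in>{B\<in>?N. card B = j}. u (card B)) = real (spread_number K (card A) j) * u j" by simp
  qed
  finally show ?thesis .
qed

text \<open>The slack \<open>n * d\<close> eventually pays for losses that do not depend on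
  \<open>n\<close>: a factor \<open>C + 1\<close> per comparable set for the growth of polynomial
  values, and one bit per coefficient for rounding \<open>P\<close> down. Zero rates admit no slack
  and are treated separately: if a row of \<open>r\<close> vanishes then \<open>P = 1\<close>, and
  \<open>C * (P - 1) + 1\<close> is exactly \<open>1\<close>, so a single message suffices as
  carrier.\<close>

lemma eventually_exchange_map:
  assumes R: "R \<in> {1..K} \<rightarrow>\<^sub>E {0..}" and R': "R' \<in> {1..K} \<rightarrow>\<^sub>E {0..}"
    and r: "\<And>i j. 0 \<le> r i j" and d: "0 < d"
    and supplied: "\<And>i. i \<in> {1..K} \<Longrightarrow> (\<forall>j\<in>{1..K}. r i j = 0) \<or> (\<Sum>j=1..K. r i j) + d \<le> R i"
    and demanded: "\<And>j. j \<in> {1..K} \<Longrightarrow> R' j = 0 \<or> R' j + d \<le> (\<Sum>i=1..K. exchange_rate K i j * r i j)"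
  shows "\<forall>\<^sub>F n in sequentially.
     \<exists>h \<in> Pi\<^sub>E (receiver_sets K) (message_set n R') \<rightarrow> Pi\<^sub>E (receiver_sets K) (message_set n R).
       determines_messages K n R' h"
proof -
  let ?RS = "receiver_sets K"
  define x where "x = to_nat_on ?RS"
  define C where "C = (\<Sum>A\<in>?RS. \<Sum>B\<in>?RS. \<Sum>m<recovery_number K (card A) (card B). x A ^ m)"
  define E where "E = (\<Sum>j=1..K. \<Sum>i=1..K. recovery_number K i j)"
  define L where "L = max (log 2 (real ((C + 1) ^ card ?RS))) (real E)"
  have "\<forall>\<^sub>F n in sequentially. L \<le> real n * d"
  proof -
    obtain N where "L < real N * d" using reals_Archimedean3[OF d] by blast
    then have "L \<le> real n * d" if "N \<le> n" for n
      using mult_right_mono[of "real N" "real n" d] that d by linarith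
    then show ?thesis by (intro eventually_sequentiallyI)
  qed
  then show ?thesis
  proof eventually_elim
    case (elim n)
    \<comment> \<open>The rate \<open>r i j\<close> carried by a set of size \<open>i\<close> is
      shared equally by its \<open>spread_number K i j\<close> comparable sets of size
      \<open>j\<close>.\<close>
    define a where "a i j = real n * (r i j / real (spread_number K i j))" for i j
    define P where "P i j = nat \<lfloor>2 powr a i j\<rfloor>" for i j
    have a: "0 \<le> a i j" for i j using r by (simp add: a_def)
    note P = floor_powr_bounds[OF a, folded P_def]
    have C1: "real ((C + 1) ^ card ?RS) \<le> 2 powr (real n * d)"
    proof -
      have "real ((C + 1) ^ card ?RS) = 2 powr (log 2 (real ((C + 1) ^ card ?RS)))"
        by (rule powr_log_cancel[symmetric]) auto
      also have "\<dots> \<le> 2 powr (real n * d)" using elim by (intro powr_mono) (auto simp: L_def)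
      finally show ?thesis .
    qed
    show ?case
    proof (rule exists_exchange_map[where P = P and x = x and C = C])
      show "1 \<le> P i j" for i j by (rule P)
      show "inj_on x ?RS" unfolding x_def by (intro inj_on_to_nat_on countable_finite) simp
      show "(\<Sum>m<recovery_number K (card A) (card B). x A ^ m) \<le> C" if "A \<in> ?RS" "B \<in> ?RS" for A B
      proof -
        have "(\<Sum>m<recovery_number K (card A) (card B). x A ^ m)
            \<le> (\<Sum>B\<in>?RS. \<Sum>m<recovery_number K (card A) (card B). x A ^ m)"
          by (rule member_le_sum[OF that(2)]) auto
        also have "\<dots> \<le> C" unfolding C_def by (rule member_le_sum[OF that(1)]) auto
        finally show ?thesis .
      qed
    next
      fix A assume A: "A \<in> ?RS"
      note rA = receiver_setsD(3,4)[OF A]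
      let ?N = "{B\<in>?RS. comparable A B}"
      show "(\<Prod>B\<in>?N. C * (P (card A) (card B) - 1) + 1) \<le> card (message_set n R A)"
      proof (cases "\<forall>j\<in>{1..K}. r (card A) j = 0")
        case True
        have "P (card A) (card B) = 1" if "B \<in> ?N" for B
          using True that receiver_setsD(3,4)[of B K] by (simp add: P_def a_def)
        then have "(\<Prod>B\<in>?N. C * (P (card A) (card B) - 1) + 1) = 1" by simp
        then show ?thesis using one_le_card_message_set[OF R A] by simp
      next
        case False
        then have sup: "(\<Sum>j=1..K. r (card A) j) + d \<le> R (card A)" using supplied[of "card A"] rA by auto
        have "real (\<Prod>B\<in>?N. C * (P (card A) (card B) - 1) + 1) = (\<Prod>B\<in>?N. real (C * (P (card A) (card B) - 1) + 1))"
          by (rule of_nat_prod)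
        also have "\<dots> \<le> (\<Prod>B\<in>?N. real (C + 1) * 2 powr a (card A) (card B))"
        proof (intro prod_mono conjI)
          fix B
          have "C * (P (card A) (card B) - 1) + 1 \<le> C * P (card A) (card B) + P (card A) (card B)"
            using P(1)[of "card A" "card B"] by (intro add_mono mult_left_mono) auto
          also have "\<dots> = (C + 1) * P (card A) (card B)" by simp
          finally have "real (C * (P (card A) (card B) - 1) + 1) \<le> real (C + 1) * real (P (card A) (card B))"
            unfolding of_nat_mult[symmetric] of_nat_le_iff .
          also have "\<dots> \<le> real (C + 1) * 2 powr a (card A) (card B)"
            by (intro mult_left_mono P) auto
          finally show "real (C * (P (card A) (card B) - 1) + 1) \<le> real (C + 1) * 2 powr a (card A) (card B)" .
        qed simp
        also have "\<dots> = real ((C + 1) ^ card ?N) * 2 powr (\<Sum>B\<in>?N. a (card A) (card B))"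
          by (simp add: prod.distrib powr_sum)
        also have "(\<Sum>B\<in>?N. a (card A) (card B)) = real n * (\<Sum>j=1..K. r (card A) j)"
        proof -
          have "(\<Sum>B\<in>?N. a (card A) (card B)) = (\<Sum>j=1..K. real (spread_number K (card A) j) * a (card A) j)"
            by (rule sum_comparable[OF A])
          also have "\<dots> = (\<Sum>j=1..K. real n * r (card A) j)"
            using spread_number_pos by (intro sum.cong refl) (auto simp: a_def)
          finally show ?thesis by (simp add: sum_distrib_left)
        qed
        also have "real ((C + 1) ^ card ?N) * 2 powr (real n * (\<Sum>j=1..K. r (card A) j))
            \<le> 2 powr (real n * d) * 2 powr (real n * (\<Sum>j=1..K. r (card A) j))"
        proof (intro mult_right_mono)
          have "(C + 1) ^ card ?N \<le> (C + 1) ^ card ?RS"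
            by (intro power_increasing card_mono) auto
          then show "real ((C + 1) ^ card ?N) \<le> 2 powr (real n * d)" using C1 by linarith
        qed simp
        also have "\<dots> = 2 powr (real n * (d + (\<Sum>j=1..K. r (card A) j)))"
          by (simp add: powr_add distrib_left)
        also have "\<dots> \<le> 2 powr (real n * R (card A))"
          using sup by (intro powr_mono mult_left_mono) auto
        finally show ?thesis unfolding card_message_set by (rule le_nat_floor)
      qed
    next
      fix B assume B: "B \<in> ?RS"
      note rB = receiver_setsD(3,4)[OF B]
      let ?d = "\<lambda>i. recovery_number K i (card B)"
      show "card (message_set n R' B) \<le> (\<Prod>i=1..K. P i (card B) ^ ?d i)"
      proof (cases "R' (card B) = 0")
        case True
        then have "card (message_set n R' B) = 1" by (simp add: card_message_set)
        also have "\<dots> \<le> (\<Prod>i=1..K. P i (card B) ^ ?d i)"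
          using P(1) by (intro prod_ge_1 one_le_power) auto
        finally show ?thesis .
      next
        case False
        then have dem: "R' (card B) + d \<le> (\<Sum>i=1..K. exchange_rate K i (card B) * r i (card B))"
          using demanded[of "card B"] rB by auto
        have R'B: "0 \<le> R' (card B)" using R' rB by (auto simp: PiE_iff)
        have "(\<Sum>i=1..K. ?d i) \<le> E"
          unfolding E_def by (rule member_le_sum[of "card B" "{1..K}" "\<lambda>j. \<Sum>i=1..K. recovery_number K i j"]) (use rB in auto)
        then have "real (\<Sum>i=1..K. ?d i) \<le> real E" unfolding of_nat_le_iff .
        also have "\<dots> \<le> real n * d" using elim by (simp add: L_def)
        finally have E: "real (\<Sum>i=1..K. ?d i) \<le> real n * d" .
        have "real (card (message_set n R' B)) \<le> 2 powr (real n * R' (card B))"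
          unfolding card_message_set using R'B by (intro floor_powr_bounds) auto
        also have "\<dots> \<le> 2 powr ((\<Sum>i=1..K. real (?d i) * a i (card B)) - real (\<Sum>i=1..K. ?d i))"
        proof (intro powr_mono)
          have "(\<Sum>i=1..K. real (?d i) * a i (card B)) = real n * (\<Sum>i=1..K. exchange_rate K i (card B) * r i (card B))"
            unfolding sum_distrib_left by (intro sum.cong refl) (simp add: a_def exchange_rate_eq)
          moreover have "real n * (R' (card B) + d) \<le> real n * (\<Sum>i=1..K. exchange_rate K i (card B) * r i (card B))"
            by (intro mult_left_mono dem) simp
          ultimately show "real n * R' (card B) \<le> (\<Sum>i=1..K. real (?d i) * a i (card B)) - real (\<Sum>i=1..K. ?d i)"
            using E by (simp add: distrib_left)
        qed simp
        also have "\<dots> = 2 powr (\<Sum>i=1..K. real (?d i) * (a i (card B) - 1))"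
          by (simp add: right_diff_distrib sum_subtractf)
        also have "\<dots> = (\<Prod>i=1..K. 2 powr (real (?d i) * (a i (card B) - 1)))"
          by (simp add: powr_sum)
        also have "\<dots> = (\<Prod>i=1..K. (2 powr a i (card B) / 2) ^ ?d i)"
        proof (intro prod.cong refl)
          fix i
          have "2 powr (real (?d i) * (a i (card B) - 1)) = (2 powr (a i (card B) - 1)) powr real (?d i)"
            by (simp add: powr_powr mult.commute)
          also have "\<dots> = (2 powr (a i (card B) - 1)) ^ ?d i"
            by (rule powr_realpow) simp
          finally show "2 powr (real (?d i) * (a i (card B) - 1)) = (2 powr a i (card B) / 2) ^ ?d i"
            by (simp add: powr_diff)
        qed
        also have "\<dots> \<le> (\<Prod>i=1..K. real (P i (card B)) ^ ?d i)"
          by (intro prod_mono conjI power_mono P) auto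
        also have "\<dots> = real (\<Prod>i=1..K. P i (card B) ^ ?d i)" by simp
        finally show ?thesis unfolding of_nat_le_iff .
      qed
    qed
  qed
qed

lemma exchange_rate_nonneg: "0 \<le> exchange_rate K i j"
  by (simp add: exchange_rate_eq)

text \<open>\<open>Rs\<close> may be a mere limit of achievable vectors, so an achievable
  \<open>Ro\<close> within \<open>d\<close> of it takes its place, and every \<open>r i j\<close> is
  lowered by \<open>2 * d\<close>, cut off at zero. A row that does not vanish then loses at least
  \<open>2 * d\<close>: one \<open>d\<close> covers the distance to \<open>Ro\<close>, the other is
  slack. The demands are lowered by \<open>d * (2 * F + 1)\<close>: with \<open>F\<close> the sum of
  all exchange rates, \<open>2 * d * F\<close> bounds the loss of a column, and the last
  \<open>d\<close> is slack.\<close>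

lemma exchange_region_subset_capacity_region:
  fixes p :: "('a, 'b) channel"
  assumes p: "is_broadcast_channel K p" and Rs: "Rs \<in> capacity_region K p"
  shows "exchange_region K Rs \<subseteq> capacity_region K p"
proof
  fix R assume "R \<in> exchange_region K Rs"
  then obtain r where ext: "R \<in> extensional {1..K}"
    and r: "\<And>i j. i \<in> {1..K} \<Longrightarrow> j \<in> {1..K} \<Longrightarrow> 0 \<le> r i j"
    and supplied: "\<And>i. i \<in> {1..K} \<Longrightarrow> (\<Sum>j=1..K. r i j) \<le> Rs i"
    and R0: "\<And>j. j \<in> {1..K} \<Longrightarrow> 0 \<le> R j"
    and demanded: "\<And>j. j \<in> {1..K} \<Longrightarrow> R j \<le> (\<Sum>i=1..K. exchange_rate K i j * r i j)"
    unfolding exchange_region_def by blast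
  have "\<exists>R'. symmetrically_achievable K p R' \<and> (\<forall>i\<in>{1..K}. \<bar>R' i - R i\<bar> < e)" if e: "0 < e" for e
  proof -
    define F where "F = (\<Sum>j=1..K. \<Sum>i=1..K. exchange_rate K i j)"
    have F: "0 \<le> F" unfolding F_def by (intro sum_nonneg exchange_rate_nonneg)
    define d where "d = e / (2 * (2 * F + 1))"
    have d: "0 < d" using e F by (simp add: d_def)
    have "d * X = e / 2" if "X \<noteq> 0" "d = e / (2 * X)" for X using that by simp
    from this[of "2 * F + 1"] have "d * (2 * F + 1) = e / 2" using F by (simp add: d_def)
    then have de: "d * (2 * F + 1) < e" using e by simp
    from Rs d obtain Ro where Ro: "symmetrically_achievable K p Ro" "\<And>i. i \<in> {1..K} \<Longrightarrow> \<bar>Ro i - Rs i\<bar> < d"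
      unfolding mem_capacity_region_iff by blast
    have Ro0: "Ro \<in> {1..K} \<rightarrow>\<^sub>E {0..}" using Ro(1) by (simp add: symmetrically_achievable_def)
    define r' where "r' i j = max 0 (r i j - 2 * d)" for i j
    define R' where "R' = (\<lambda>j\<in>{1..K}. max 0 (R j - d * (2 * F + 1)))"
    have "symmetrically_achievable K p R'"
    proof (rule symmetrically_achievable_recoded[OF p _ Ro(1) eventually_exchange_map[OF Ro0, where r = r' and d = d]])
      show "R' \<in> {1..K} \<rightarrow>\<^sub>E {0..}" "R' \<in> {1..K} \<rightarrow>\<^sub>E {0..}" by (auto simp: R'_def)
      show "0 \<le> r' i j" for i j by (simp add: r'_def)
      show "0 < d" by (rule d)
      show "(\<forall>j\<in>{1..K}. r' i j = 0) \<or> (\<Sum>j=1..K. r' i j) + d \<le> Ro i" if i: "i \<in> {1..K}" for i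
      proof (rule disjCI)
        assume "\<not> (\<Sum>j=1..K. r' i j) + d \<le> Ro i"
        show "\<forall>j\<in>{1..K}. r' i j = 0"
        proof (rule ccontr)
          assume "\<not> ?thesis"
          then obtain j0 where j0: "j0 \<in> {1..K}" "r' i j0 \<noteq> 0" by blast
          have "(\<Sum>j=1..K. r' i j) = r' i j0 + (\<Sum>j\<in>{1..K} - {j0}. r' i j)"
            using j0 by (simp add: sum.remove)
          also have "\<dots> \<le> (r i j0 - 2 * d) + (\<Sum>j\<in>{1..K} - {j0}. r i j)"
          proof (intro add_mono sum_mono)
            show "r' i j0 \<le> r i j0 - 2 * d" using j0 by (auto simp: r'_def max_def split: if_splits)
            show "r' i j \<le> r i j" if "j \<in> {1..K} - {j0}" for j
              using r[OF i, of j] that d by (auto simp: r'_def)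
          qed
          also have "\<dots> = (\<Sum>j=1..K. r i j) - 2 * d" using j0 by (simp add: sum.remove)
          finally have "(\<Sum>j=1..K. r' i j) + d \<le> Ro i" using supplied[OF i] Ro(2)[OF i] by linarith
          then show False using \<open>\<not> (\<Sum>j=1..K. r' i j) + d \<le> Ro i\<close> by simp
        qed
      qed
      show "R' j = 0 \<or> R' j + d \<le> (\<Sum>i=1..K. exchange_rate K i j * r' i j)" if j: "j \<in> {1..K}" for j
      proof -
        have "(\<Sum>i=1..K. exchange_rate K i j * r i j) - 2 * d * (\<Sum>i=1..K. exchange_rate K i j)
            = (\<Sum>i=1..K. exchange_rate K i j * (r i j - 2 * d))"
          by (simp add: right_diff_distrib sum_subtractf sum_distrib_left mult_ac)
        also have "\<dots> \<le> (\<Sum>i=1..K. exchange_rate K i j * r' i j)"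
          by (intro sum_mono mult_left_mono exchange_rate_nonneg) (simp add: r'_def)
        finally have 1: "(\<Sum>i=1..K. exchange_rate K i j * r i j) - 2 * d * (\<Sum>i=1..K. exchange_rate K i j)
            \<le> (\<Sum>i=1..K. exchange_rate K i j * r' i j)" .
        have "(\<Sum>i=1..K. exchange_rate K i j) \<le> F"
          unfolding F_def using j
          by (intro member_le_sum[of j "{1..K}" "\<lambda>j. \<Sum>i=1..K. exchange_rate K i j"] sum_nonneg exchange_rate_nonneg) auto
        then have "2 * d * (\<Sum>i=1..K. exchange_rate K i j) \<le> 2 * d * F" using d by (intro mult_left_mono) auto
        then have "R j - d * (2 * F + 1) + d \<le> (\<Sum>i=1..K. exchange_rate K i j * r' i j)"
          using 1 demanded[OF j] by (simp add: algebra_simps)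
        then show ?thesis using j by (auto simp: R'_def max_def)
      qed
    qed
    moreover have "\<bar>R' i - R i\<bar> < e" if "i \<in> {1..K}" for i
      using R0[OF that] that de d F mult_pos_pos[of d "2 * F + 1"] by (auto simp: R'_def max_def)
    ultimately show ?thesis by blast
  qed
  then show "R \<in> capacity_region K p" unfolding mem_capacity_region_iff using ext by blast
qed

section \<open>The link channel and the converse\<close>

text \<open>Increments of \<open>\<lceil>t * Rs i\<rceil>\<close>: sums over a block telescope, so
  that rounding is paid once per block and not at each time.\<close>

definition link_bits :: "(nat \<Rightarrow> real) \<Rightarrow> nat \<Rightarrow> nat \<Rightarrow> nat" where
  "link_bits Rs i t = nat (\<lceil>real (Suc t) * Rs i\<rceil> - \<lceil>real t * Rs i\<rceil>)"

lemma sum_link_bits: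
  assumes "0 \<le> Rs i"
  shows "(\<Sum>t<n. link_bits Rs i t) = nat \<lceil>real n * Rs i\<rceil>"
proof (induction n)
  case (Suc n)
  have "real n * Rs i \<le> real (Suc n) * Rs i" using assms by (intro mult_right_mono) auto
  then have le: "\<lceil>real n * Rs i\<rceil> \<le> \<lceil>real (Suc n) * Rs i\<rceil>" by (rule ceiling_mono)
  have "0 \<le> real n * Rs i" using assms by simp
  then have "0 \<le> \<lceil>real n * Rs i\<rceil>" by linarith
  have "(\<Sum>t<Suc n. link_bits Rs i t) = nat \<lceil>real n * Rs i\<rceil> + nat (\<lceil>real (Suc n) * Rs i\<rceil> - \<lceil>real n * Rs i\<rceil>)"
    by (simp only: sum.lessThan_Suc Suc.IH) (simp only: link_bits_def)
  also have "\<dots> = nat \<lceil>real (Suc n) * Rs i\<rceil>"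
    using le \<open>0 \<le> \<lceil>real n * Rs i\<rceil>\<close> by (simp add: nat_add_distrib[symmetric])
  finally show ?case .
qed simp

definition signals :: "nat \<Rightarrow> (nat set \<Rightarrow> nat) set" where
  "signals K = (\<Pi>\<^sub>E A\<in>receiver_sets K. UNIV)"

text \<open>
  The deterministic channel with one noiseless link to each nonempty set of users. The link to \<open>A\<close>
  carries \<open>link_bits Rs (card A) t\<close> bits at time \<open>t\<close>: the widths vary with time so that a block of
  length \<open>n\<close> carries exactly \<open>\<lceil>n * Rs (card A)\<rceil>\<close> bits for every real rate.
  The maps \<open>inp\<close> and \<open>outp\<close> translate between letters and tuples of link signals.
\<close>

locale link_channel =
  fixes K :: nat and Rs :: "nat \<Rightarrow> real" and inp :: "'a \<Rightarrow> (nat set \<Rightarrow> nat)" and outp :: "(nat set \<Rightarrow> nat) \<Rightarrow> 'b"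
  assumes Rs: "Rs \<in> {1..K} \<rightarrow>\<^sub>E {0..}"
    and inp_surj: "signals K \<subseteq> range inp"
    and outp_inj: "inj_on outp (signals K)"
begin

text \<open>A signal may carry any natural number on each link, which keeps the alphabet the same at
  all times; reduction modulo a power of two imposes the width valid at time \<open>t\<close>. Links
  that \<open>k\<close> does not hear read \<open>0\<close>.\<close>

definition seen :: "nat \<Rightarrow> nat \<Rightarrow> (nat set \<Rightarrow> nat) \<Rightarrow> (nat set \<Rightarrow> nat)" where
  "seen k t v = (\<lambda>A\<in>receiver_sets K. if k \<in> A then v A mod 2 ^ link_bits Rs (card A) t else 0)"

definition letter :: "nat \<Rightarrow> nat \<Rightarrow> 'a \<Rightarrow> 'b" where
  "letter k t a = outp (seen k t (inp a))"

definition chan :: "('a, 'b) channel" where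
  "chan = \<lparr>input_alphabet = count_space UNIV, output_alphabet = (\<lambda>_. count_space (outp ` signals K)),
     channel_law = (\<lambda>x. return (\<Pi>\<^sub>M k\<in>{1..K}. \<Pi>\<^sub>M t\<in>UNIV. count_space (outp ` signals K))
       (\<lambda>k\<in>{1..K}. \<lambda>t. letter k t (x t)))\<rparr>"

lemma Rs_nonneg: "A \<in> receiver_sets K \<Longrightarrow> 0 \<le> Rs (card A)"
  using Rs receiver_setsD(3,4)[of A K] by (auto simp: PiE_iff)

lemma seen_in_signals: "seen k t v \<in> signals K"
  by (simp add: seen_def signals_def)

lemma letter_in: "letter k t a \<in> outp ` signals K"
  by (simp add: letter_def seen_in_signals)

lemma letter_eq_iff: "letter k t a = letter k t b \<longleftrightarrow> seen k t (inp a) = seen k t (inp b)"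
  unfolding letter_def using inj_on_eq_iff[OF outp_inj seen_in_signals seen_in_signals] .

lemma input_space_chan: "input_space chan T = (\<Pi>\<^sub>M t\<in>T. count_space UNIV)"
  by (simp add: input_space_def chan_def)

lemma user_space_chan: "user_space chan T k = (\<Pi>\<^sub>M t\<in>T. count_space (outp ` signals K))"
  by (simp add: user_space_def chan_def)

lemma output_space_chan: "output_space K chan T = (\<Pi>\<^sub>M k\<in>{1..K}. \<Pi>\<^sub>M t\<in>T. count_space (outp ` signals K))"
  by (simp add: output_space_def user_space_chan)

lemma channel_law_chan: "channel_law chan x = return (output_space K chan UNIV) (\<lambda>k\<in>{1..K}. \<lambda>t. letter k t (x t))"
  unfolding output_space_chan by (simp add: chan_def)

lemma outputs_measurable:
  "(\<lambda>x. \<lambda>k\<in>{1..K}. \<lambda>t. letter k t (x t)) \<in> input_space chan UNIV \<rightarrow>\<^sub>M output_space K chan UNIV"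
  unfolding output_space_chan
proof (rule measurable_restrict)
  fix k
  show "(\<lambda>x t. letter k t (x t)) \<in> input_space chan UNIV \<rightarrow>\<^sub>M (\<Pi>\<^sub>M t\<in>UNIV. count_space (outp ` signals K))"
  proof (rule measurable_PiM_single')
    fix t
    have "(\<lambda>x. x t) \<in> input_space chan UNIV \<rightarrow>\<^sub>M count_space UNIV"
      unfolding input_space_chan by (rule measurable_component_singleton) simp
    moreover have "letter k t \<in> count_space UNIV \<rightarrow>\<^sub>M count_space (outp ` signals K)"
      using letter_in by simp
    ultimately show "(\<lambda>x. letter k t (x t)) \<in> input_space chan UNIV \<rightarrow>\<^sub>M count_space (outp ` signals K)"
      by (rule measurable_compose)
  qed (use letter_in in auto)
qed

definition block_outputs :: "nat \<Rightarrow> (nat \<Rightarrow> 'a) \<Rightarrow> nat \<Rightarrow> nat \<Rightarrow> 'b" where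
  "block_outputs n x = (\<lambda>k\<in>{1..K}. \<lambda>t\<in>{..<n}. letter k t (x t))"

lemma first_outputs_law_chan: "first_outputs_law K chan n x = return (output_space K chan {..<n}) (block_outputs n x)"
proof -
  have "x \<in> space (input_space chan UNIV)" by (simp add: input_space_chan space_PiM)
  then have "(\<lambda>k\<in>{1..K}. \<lambda>t. letter k t (x t)) \<in> space (output_space K chan UNIV)"
    using measurable_space[OF outputs_measurable] by simp
  then have "first_outputs_law K chan n x
    = return (output_space K chan {..<n}) (first_outputs K n (\<lambda>k\<in>{1..K}. \<lambda>t. letter k t (x t)))"
    unfolding first_outputs_law_def channel_law_chan
    by (intro distr_return first_outputs_measurable)
  moreover have "first_outputs K n (\<lambda>k\<in>{1..K}. \<lambda>t. letter k t (x t)) = block_outputs n x"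
    by (auto simp: first_outputs_def block_outputs_def fun_eq_iff)
  ultimately show ?thesis by simp
qed

lemma block_law_chan: "block_law K chan n x = return (output_space K chan {..<n}) (block_outputs n x)"
  unfolding block_law_def first_outputs_law_chan
  by (rule arg_cong[where f = "return _"]) (auto simp: block_outputs_def fun_eq_iff)

lemma is_broadcast_channel_chan: "is_broadcast_channel K chan"
  unfolding is_broadcast_channel_def
proof (intro conjI allI ballI impI)
  show "space (input_alphabet chan) \<noteq> {}" by (simp add: chan_def)
  have "(\<lambda>x. return (output_space K chan UNIV) (\<lambda>k\<in>{1..K}. \<lambda>t. letter k t (x t)))
    \<in> input_space chan UNIV \<rightarrow>\<^sub>M prob_algebra (output_space K chan UNIV)"
    by (rule measurable_compose[OF outputs_measurable measurable_return_prob_space])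
  then show "channel_law chan \<in> input_space chan UNIV \<rightarrow>\<^sub>M prob_algebra (output_space K chan UNIV)"
    by (simp add: channel_law_chan[abs_def])
  fix n and x x' :: "nat \<Rightarrow> 'a" assume "\<forall>t<n. x t = x' t"
  then have "block_outputs n x = block_outputs n x'" by (auto simp: block_outputs_def fun_eq_iff)
  then show "first_outputs_law K chan n x = first_outputs_law K chan n x'"
    by (simp add: first_outputs_law_chan)
qed

lemma countable_letters: "countable (outp ` signals K)"
  unfolding signals_def by (intro countable_image countable_PiE) auto

text \<open>Finite blocks over a countable alphabet form a discrete space, so measurability of
  decoders is automatic.\<close>

lemma user_space_chan_block: "user_space chan {..<n} k = count_space (\<Pi>\<^sub>E t\<in>{..<n}. outp ` signals K)"
  unfolding user_space_chan by (rule count_space_PiM_finite) (auto simp: countable_letters)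

lemma block_outputs_in: "block_outputs n x \<in> space (output_space K chan {..<n})"
  using letter_in by (auto simp: block_outputs_def output_space_chan space_PiM)

lemma measure_block_law_chan:
  assumes "is_code K chan n R f g"
  shows "measure (block_law K chan n x) (error_event K chan n g w)
    = (if \<exists>k\<in>{1..K}. \<exists>A\<in>receiver_sets K. k \<in> A \<and> w A \<noteq> g k (block_outputs n x k) A then 1 else 0)"
  unfolding block_law_chan
  using error_event_measurable[OF assms] block_outputs_in by (subst measure_return) (auto simp: indicator_def)

definition link_words :: "nat \<Rightarrow> nat set \<Rightarrow> (nat \<Rightarrow> nat) set" where
  "link_words n A = (\<Pi>\<^sub>E t\<in>{..<n}. {..<2 ^ link_bits Rs (card A) t})"

lemma finite_link_words: "finite (link_words n A)"
  unfolding link_words_def by (intro finite_PiE) auto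

lemma card_link_words:
  assumes "A \<in> receiver_sets K"
  shows "card (link_words n A) = 2 ^ nat \<lceil>real n * Rs (card A)\<rceil>"
proof -
  have "card (link_words n A) = (\<Prod>t<n. 2 ^ link_bits Rs (card A) t)"
    unfolding link_words_def by (subst card_PiE) auto
  then show ?thesis
    using sum_link_bits[of Rs "card A", OF Rs_nonneg[OF assms]] by (simp add: power_sum[symmetric])
qed

lemma card_message_set_le_link_words:
  assumes "A \<in> receiver_sets K"
  shows "card (message_set n Rs A) \<le> card (link_words n A)"
proof -
  have nonneg: "0 \<le> real n * Rs (card A)" using Rs_nonneg[OF assms] by simp
  then have "real (card (message_set n Rs A)) \<le> 2 powr (real n * Rs (card A))"
    unfolding card_message_set by (rule floor_powr_bounds)
  also have "\<dots> \<le> 2 powr real (nat \<lceil>real n * Rs (card A)\<rceil>)"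
    by (intro powr_mono) (auto simp: real_nat_ceiling_ge)
  also have "\<dots> = real (card (link_words n A))"
    by (simp add: card_link_words[OF assms] powr_realpow)
  finally show ?thesis by simp
qed

text \<open>Each message travels on the link for its own set, which has room for it because block
  capacities are rounded up and message sizes down. A decoder may pick any message tuple consistent
  with its output, since the link words heard by \<open>k\<close> determine the messages for
  \<open>k\<close>.\<close>

lemma exists_error_free_code:
  "\<exists>f g. is_code K chan n Rs f g \<and> error_probability K chan n Rs f g = 0"
proof -
  let ?N = "Pi\<^sub>E (receiver_sets K) (message_set n Rs)"
  let ?at = "\<lambda>k. {A\<in>receiver_sets K. k \<in> A}"
  have "\<exists>c. \<forall>A\<in>receiver_sets K. c A ` message_set n Rs A \<subseteq> link_words n A \<and> inj_on (c A) (message_set n Rs A)"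
    by (intro bchoice ballI card_le_inj finite_message_set finite_link_words card_message_set_le_link_words)
  then obtain c where c: "\<And>A. A \<in> receiver_sets K \<Longrightarrow> c A ` message_set n Rs A \<subseteq> link_words n A"
      "\<And>A. A \<in> receiver_sets K \<Longrightarrow> inj_on (c A) (message_set n Rs A)"
    by blast
  define sig where "sig w t = (\<lambda>A\<in>receiver_sets K. c A (w A) t)" for w t
  define f where "f w = (\<lambda>t\<in>{..<n}. SOME a. inp a = sig w t)" for w
  have inp_f: "inp (f w t) = sig w t" if "t < n" for w t
  proof -
    have "sig w t \<in> range inp" using inp_surj by (auto simp: sig_def signals_def)
    then have "\<exists>a. inp a = sig w t" by (metis rangeE)
    then have "inp (SOME a. inp a = sig w t) = sig w t" by (rule someI_ex)
    then show ?thesis using that by (simp add: f_def)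
  qed
  define consistent where "consistent k y w \<longleftrightarrow> w \<in> ?N \<and> y = block_outputs n (f w) k" for k y w
  define g where "g k y = restrict (if Ex (consistent k y) then Eps (consistent k y) else (SOME w. w \<in> ?N)) (?at k)" for k y
  have g: "g k y \<in> Pi\<^sub>E (?at k) (message_set n Rs)" for k y
  proof -
    have "(if Ex (consistent k y) then Eps (consistent k y) else (SOME w. w \<in> ?N)) \<in> ?N"
    proof (cases "Ex (consistent k y)")
      case True
      then show ?thesis using someI_ex[OF True] by (simp add: consistent_def[of k y "Eps _"])
    next
      case False
      show ?thesis unfolding if_not_P[OF False] some_in_eq by (rule messages_ne[OF Rs])
    qed
    then show ?thesis unfolding g_def by (auto simp: PiE_iff)
  qed
  have code: "is_code K chan n Rs f g"
    unfolding is_code_def user_space_chan_block using g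
    by (auto simp: input_space_chan space_PiM f_def)
  have ok: "w A = g k (block_outputs n (f w) k) A"
    if w: "w \<in> ?N" and k: "k \<in> {1..K}" and A: "A \<in> receiver_sets K" "k \<in> A" for w k A
  proof -
    let ?y = "block_outputs n (f w) k"
    define w' where "w' = Eps (consistent k ?y)"
    have "consistent k ?y w" using w by (simp add: consistent_def)
    then have ex: "Ex (consistent k ?y)" by blast
    then have c': "consistent k ?y w'" unfolding w'_def by (rule someI_ex)
    then have w': "w' \<in> ?N" by (simp add: consistent_def)
    have in_words: "c A (w A) \<in> link_words n A" "c A (w' A) \<in> link_words n A"
      using c(1)[OF A(1)] w w' A by (auto simp: PiE_iff image_subset_iff)
    have "c A (w A) t = c A (w' A) t" if t: "t < n" for t
    proof -
      have "block_outputs n (f w) k t = block_outputs n (f w') k t" using c' by (simp add: consistent_def)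
      then have "seen k t (sig w t) = seen k t (sig w' t)"
        using k t by (simp add: block_outputs_def letter_eq_iff inp_f)
      then have "seen k t (sig w t) A = seen k t (sig w' t) A" by simp
      then have "c A (w A) t mod 2 ^ link_bits Rs (card A) t = c A (w' A) t mod 2 ^ link_bits Rs (card A) t"
        using A by (simp add: seen_def sig_def)
      moreover have "c A (w A) t < 2 ^ link_bits Rs (card A) t" "c A (w' A) t < 2 ^ link_bits Rs (card A) t"
        using in_words t by (auto simp: link_words_def PiE_iff)
      ultimately show ?thesis by simp
    qed
    then have "c A (w A) = c A (w' A)"
      using in_words by (intro PiE_ext[where k = "{..<n}"]) (auto simp: link_words_def)
    moreover have "w A \<in> message_set n Rs A" "w' A \<in> message_set n Rs A" using w w' A by auto
    ultimately have "w A = w' A" using c(2)[OF A(1)] by (auto dest: inj_onD)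
    then show ?thesis using ex A by (simp add: g_def w'_def)
  qed
  have "measure (block_law K chan n (f w)) (error_event K chan n g w) = 0" if "w \<in> ?N" for w
    unfolding measure_block_law_chan[OF code] using ok[OF that] by auto
  then have "error_probability K chan n Rs f g = 0"
    unfolding error_probability_eq[OF Rs] by simp
  then show ?thesis using code by blast
qed

lemma Rs_in_capacity_region: "Rs \<in> capacity_region K chan"
proof -
  obtain f g where "\<And>n. is_code K chan n Rs (f n) (g n) \<and> error_probability K chan n Rs (f n) (g n) = 0"
    using exists_error_free_code by metis
  then have "symmetrically_achievable K chan Rs"
    unfolding symmetrically_achievable_def using Rs
    by (intro conjI exI[of _ f] exI[of _ g]) auto
  then show ?thesis
    unfolding mem_capacity_region_iff using Rs by (auto simp: PiE_def intro!: exI[of _ Rs])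
qed

end

section \<open>Converse for the link channel\<close>

context link_channel
begin

lemma log_card_link_words:
  assumes "A \<in> receiver_sets K"
  shows "log 2 (real (card (link_words n A))) \<le> real n * Rs (card A) + 1"
proof -
  have "log 2 (real (card (link_words n A))) = real (nat \<lceil>real n * Rs (card A)\<rceil>)"
    by (simp add: card_link_words[OF assms])
  also have "\<dots> \<le> real n * Rs (card A) + 1"
    using Rs_nonneg[OF assms] by (simp add: of_nat_nat)
  finally show ?thesis .
qed

text \<open>The losses do not grow with \<open>n\<close>: one bit per message for the floor in its
  size, one per link for the ceiling in its capacity, and \<open>l K\<close> for discarding the
  tuples that are decoded wrongly. The channel being deterministic, a tuple is decoded either always
  or never correctly, and at most half of them fail.\<close>

lemma converse_block:
  assumes R: "R \<in> {1..K} \<rightarrow>\<^sub>E {0..}" and code: "is_code K chan n R f g"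
    and err: "error_probability K chan n R f g \<le> 1 / 2" and l: "l \<in> price_cone K"
  shows "(\<Sum>B\<in>receiver_sets K. l (card B) * (real n * R (card B) - 1)) - l K
     \<le> (\<Sum>A\<in>receiver_sets K. l (card A) * (real n * Rs (card A) + 1))"
proof -
  let ?RS = "receiver_sets K"
  let ?N = "Pi\<^sub>E ?RS (message_set n R)"
  let ?bad = "\<lambda>w. \<exists>k\<in>{1..K}. \<exists>A\<in>?RS. k \<in> A \<and> w A \<noteq> g k (block_outputs n (f w) k) A"
  txt \<open>On \<open>G\<close> decoding is exact, so no error terms occur in the entropies; the restriction to \<open>G\<close> costs one bit.\<close>
  define G where "G = {w\<in>?N. \<not> ?bad w}"
  have cN: "0 < real (card ?N)" using messages_ne[OF R] by (simp add: card_gt_0_iff)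
  have "error_probability K chan n R f g = (\<Sum>w\<in>?N. if ?bad w then 1 else 0) / real (card ?N)"
    unfolding error_probability_eq[OF R] measure_block_law_chan[OF code] ..
  also have "(\<Sum>w\<in>?N. if ?bad w then 1 else 0) = real (card {w\<in>?N. ?bad w})"
    by (simp add: sum.If_cases Int_def)
  also have "{w\<in>?N. ?bad w} = ?N - G" unfolding G_def by blast
  also have "real (card (?N - G)) = real (card ?N) - real (card G)"
    unfolding G_def by (subst card_Diff_subset) (auto simp: of_nat_diff card_mono)
  finally have cG: "real (card ?N) / 2 \<le> real (card G)"
    using err cN by (simp add: divide_le_eq)
  then have G0: "0 < real (card G)" using cN by linarith
  have finG: "finite G" by (simp add: G_def)
  have neG: "G \<noteq> {}" using G0 by auto
  \<comment> \<open>Both kinds of variables need one value type, so a message becomes a constant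
    sequence, and a link word is continued by \<open>0\<close> from time \<open>n\<close>
    on.\<close>
  define X where "X w v = (case v of
      Inl A \<Rightarrow> (\<lambda>t. if t < n then inp (f w t) A mod 2 ^ link_bits Rs (card A) t else 0)
    | Inr B \<Rightarrow> (\<lambda>_. w B))" for w :: "nat set \<Rightarrow> nat" and v :: "nat set + nat set"
  define h where "h = joint_entropy G X"
  define c where "c B = log 2 (real (card (message_set n R B)))" for B
  have decode: "X w' v = X w v"
    if k: "k \<in> {1..K}" and w: "w \<in> G" "w' \<in> G"
      and eq: "\<forall>v\<in>Inl ` {A\<in>?RS. k \<in> A}. X w' v = X w v" and v: "v \<in> Inr ` {B\<in>?RS. k \<in> B}" for k w w' v
  proof -
    have "inp (f w' t) A mod 2 ^ link_bits Rs (card A) t = inp (f w t) A mod 2 ^ link_bits Rs (card A) t"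
      if A: "A \<in> ?RS" "k \<in> A" and t: "t < n" for A t
    proof -
      have "X w' (Inl A) t = X w (Inl A) t" using eq A by auto
      then show ?thesis using t by (simp add: X_def)
    qed
    then have "seen k t (inp (f w' t)) = seen k t (inp (f w t))" if "t < n" for t
      using that by (auto simp: seen_def fun_eq_iff)
    then have "block_outputs n (f w') k = block_outputs n (f w) k"
      using k by (auto simp: block_outputs_def fun_eq_iff letter_eq_iff)
    moreover obtain B where B: "v = Inr B" "B \<in> ?RS" "k \<in> B" using v by blast
    moreover have "w B = g k (block_outputs n (f w) k) B" "w' B = g k (block_outputs n (f w') k) B"
      using w B k unfolding G_def by blast+
    ultimately show ?thesis by (simp add: X_def)
  qed
  \<comment> \<open>The price cone leaves \<open>l 0\<close> open while the network requires the
    value \<open>0\<close>; no receiver set has size \<open>0\<close>, so the weighted sums are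
    unaffected.\<close>
  interpret link_network h K "l(0 := 0)"
  proof
    show "h S \<le> h T" if "S \<subseteq> T" for S T
      unfolding h_def by (rule joint_entropy_mono[OF finG neG that])
    show "h (S \<union> T) + h (S \<inter> T) \<le> h S + h T" for S T
      unfolding h_def by (rule joint_entropy_submodular[OF finG neG])
    show "h {} = 0" unfolding h_def by (rule joint_entropy_empty[OF finG neG])
    show "h (Inl ` {A\<in>?RS. k \<in> A} \<union> Inr ` {B\<in>?RS. k \<in> B}) = h (Inl ` {A\<in>?RS. k \<in> A})"
      if "k \<in> {1..K}" for k
      unfolding h_def using decode[OF that] by (intro joint_entropy_determined[OF finG neG]) blast
    show "(l(0 := 0)) 0 = 0" by simp
    show "(l(0 := 0)) i \<le> (l(0 := 0)) (Suc i)" if "i < K" for i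
      using l that by (cases "i = 0") (auto simp: price_cone_def)
    show "real i * (l(0 := 0)) (Suc i) \<le> real (Suc i) * (l(0 := 0)) i" if "i < K" for i
    proof (cases "i = 0")
      case False
      then have "i \<in> {1..<K}" using that by auto
      then show ?thesis using l False unfolding price_cone_def by simp
    qed simp
  qed
  have h_message: "h {Inr B} \<le> c B" if B: "B \<in> ?RS" for B
  proof -
    let ?Y = "(\<lambda>m (_::nat). m) ` message_set n R B"
    have "(\<lambda>w. X w (Inr B)) ` G \<subseteq> ?Y" using B by (auto simp: X_def G_def)
    then have "h {Inr B} \<le> log 2 (real (card ?Y))"
      unfolding h_def by (intro joint_entropy_singleton_le[OF finG neG]) auto
    also have "card ?Y = card (message_set n R B)"
      by (intro card_image inj_onI) (meson fun_cong)
    finally show ?thesis by (simp add: c_def)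
  qed
  have h_link: "h {Inl A} \<le> real n * Rs (card A) + 1" if A: "A \<in> ?RS" for A
  proof -
    let ?e = "\<lambda>u t. if t < n then u t else (0::nat)"
    have "(\<lambda>w. X w (Inl A)) ` G \<subseteq> ?e ` link_words n A"
    proof (rule image_subsetI)
      fix w
      let ?u = "\<lambda>t\<in>{..<n}. inp (f w t) A mod 2 ^ link_bits Rs (card A) t"
      have "X w (Inl A) = ?e ?u" by (auto simp: X_def fun_eq_iff)
      moreover have "?u \<in> link_words n A" by (auto simp: link_words_def)
      ultimately show "X w (Inl A) \<in> ?e ` link_words n A" by (rule image_eqI)
    qed
    then have "h {Inl A} \<le> log 2 (real (card (?e ` link_words n A)))"
      unfolding h_def by (intro joint_entropy_singleton_le[OF finG neG]) (auto simp: finite_link_words)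
    also have "\<dots> \<le> log 2 (real (card (link_words n A)))"
    proof (intro log_mono)
      have "link_words n A \<noteq> {}" using card_link_words[OF A, of n] by auto
      then show "0 < real (card (?e ` link_words n A))" by (simp add: card_gt_0_iff finite_link_words)
    qed (use card_image_le[OF finite_link_words] in auto)
    also note log_card_link_words[OF A]
    finally show ?thesis .
  qed
  \<comment> \<open>All messages together have entropy \<open>log 2 (card G)\<close>, at most one
    bit below the sum of all \<open>c B\<close>. By subadditivity, those of size below
    \<open>i\<close> account for at most their own \<open>c B\<close>, whatever the dependence
    within \<open>G\<close>; the rest is left for \<open>messages_from i\<close>.\<close>
  have "(\<Sum>B\<in>{B\<in>?RS. i \<le> card B}. c B) - 1 \<le> h (messages_from i)" for i
  proof -
    let ?up = "{B\<in>?RS. i \<le> card B}" and ?low = "{B\<in>?RS. \<not> i \<le> card B}"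
    have "(\<Sum>B\<in>?RS. c B) = (\<Sum>B\<in>?up. c B) + (\<Sum>B\<in>?low. c B)"
      by (subst sum.union_disjoint[symmetric]) (auto intro!: sum.cong)
    moreover have "(\<Sum>B\<in>?RS. c B) - 1 \<le> log 2 (real (card G))"
    proof -
      have "real (card ?N) = (\<Prod>B\<in>?RS. real (card (message_set n R B)))"
        by (simp add: card_PiE)
      also have "log 2 \<dots> = (\<Sum>B\<in>?RS. c B)"
      proof -
        have "message_set n R B \<noteq> {}" if "B \<in> ?RS" for B
          using one_le_card_message_set[OF R that, of n] by auto
        then show ?thesis
          unfolding c_def log_def sum_divide_distrib[symmetric]
          by (subst ln_prod) (auto simp: card_gt_0_iff)
      qed
      finally have "log 2 (real (card ?N)) = (\<Sum>B\<in>?RS. c B)" .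
      moreover have "log 2 (real (card ?N)) - 1 = log 2 (real (card ?N) / 2)"
        using cN by (simp add: log_divide_pos)
      moreover have "\<dots> \<le> log 2 (real (card G))" using cG cN by (intro log_mono) auto
      ultimately show ?thesis by simp
    qed
    moreover have "log 2 (real (card G)) = h (Inr ` ?RS)"
      unfolding h_def
    proof (rule joint_entropy_inj[OF finG neG, symmetric])
      fix w w' assume w: "w \<in> G" "w' \<in> G" and eq: "\<forall>v\<in>Inr ` ?RS. X w' v = X w v"
      have "w' B = w B" if "B \<in> ?RS" for B
        using eq that by (auto simp: X_def fun_eq_iff)
      then show "w' = w" using w unfolding G_def by (intro PiE_ext[where k = ?RS]) auto
    qed
    moreover have "Inr ` ?RS = messages_from i \<union> Inr ` ?low" by auto
    moreover have "h (messages_from i \<union> Inr ` ?low) - h (messages_from i) \<le> (\<Sum>B\<in>?low. c B)"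
    proof -
      have "h (messages_from i \<union> Inr ` ?low) - h (messages_from i)
          \<le> (\<Sum>v\<in>Inr ` ?low. h (messages_from i \<union> {v}) - h (messages_from i))"
        by (rule subadditive) simp
      also have "\<dots> = (\<Sum>B\<in>?low. h (messages_from i \<union> {Inr B}) - h (messages_from i))"
        by (subst sum.reindex) auto
      also have "\<dots> \<le> (\<Sum>B\<in>?low. c B)"
      proof (intro sum_mono)
        fix B assume B: "B \<in> ?low"
        have "h (messages_from i \<union> {Inr B}) - h (messages_from i) \<le> h ({} \<union> {Inr B}) - h {}"
          by (rule marginal_antimono) simp
        then show "h (messages_from i \<union> {Inr B}) - h (messages_from i) \<le> c B"
          using h_message[of B] B empty by simp
      qed
      finally show ?thesis .
    qed
    ultimately show ?thesis by simp
  qed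
  then have main: "(\<Sum>B\<in>?RS. (l(0 := 0)) (card B) * c B) - (l(0 := 0)) K * 1
      \<le> (\<Sum>A\<in>?RS. (l(0 := 0)) (card A) * h {Inl A})"
    by (rule weighted_link_bound)
  have l0: "(l(0 := 0)) (card B) = l (card B)" if "B \<in> ?RS" for B
    using receiver_setsD(3)[OF that] by simp
  have l_pos: "0 \<le> l i" for i using l by (simp add: price_cone_def)
  have "(\<Sum>B\<in>?RS. l (card B) * (real n * R (card B) - 1)) \<le> (\<Sum>B\<in>?RS. (l(0 := 0)) (card B) * c B)"
  proof (intro sum_mono)
    fix B assume B: "B \<in> ?RS"
    have nn: "0 \<le> real n * R (card B)"
      using R receiver_setsD(3,4)[OF B] by (auto simp: PiE_iff)
    have "real n * R (card B) - 1 = log 2 (2 powr (real n * R (card B)) / 2)"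
      by (simp add: log_divide_pos)
    also have "\<dots> \<le> c B"
      unfolding c_def card_message_set using floor_powr_bounds(3)[OF nn] by (intro log_mono) auto
    finally show "l (card B) * (real n * R (card B) - 1) \<le> (l(0 := 0)) (card B) * c B"
      unfolding l0[OF B] by (rule mult_left_mono) (rule l_pos)
  qed
  moreover have "(\<Sum>A\<in>?RS. (l(0 := 0)) (card A) * h {Inl A}) \<le> (\<Sum>A\<in>?RS. l (card A) * (real n * Rs (card A) + 1))"
  proof (intro sum_mono)
    fix A assume A: "A \<in> ?RS"
    show "(l(0 := 0)) (card A) * h {Inl A} \<le> l (card A) * (real n * Rs (card A) + 1)"
      unfolding l0[OF A] by (rule mult_left_mono[OF h_link[OF A] l_pos])
  qed
  moreover have "(l(0 := 0)) K \<le> l K" using l_pos[of 0] by simp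
  ultimately show ?thesis using main by linarith
qed

text \<open>The loss in the block inequality is constant, whereas a violation would grow linearly
  with \<open>n\<close>.\<close>

lemma converse_achievable:
  assumes ach: "symmetrically_achievable K chan R" and l: "l \<in> price_cone K"
  shows "(\<Sum>B\<in>receiver_sets K. l (card B) * R (card B)) \<le> (\<Sum>A\<in>receiver_sets K. l (card A) * Rs (card A))"
    (is "?S R \<le> ?S Rs")
proof (rule ccontr)
  assume "\<not> ?thesis"
  then have gap: "0 < ?S R - ?S Rs" by simp
  from ach obtain f g where R: "R \<in> {1..K} \<rightarrow>\<^sub>E {0..}" and code: "\<And>n. is_code K chan n R (f n) (g n)"
    and lim: "(\<lambda>n. error_probability K chan n R (f n) (g n)) \<longlonglongrightarrow> 0"
    unfolding symmetrically_achievable_def by blast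
  have "\<forall>\<^sub>F n in sequentially. error_probability K chan n R (f n) (g n) < 1 / 2"
    using lim by (rule order_tendstoD) simp
  then obtain N where N: "\<And>n. N \<le> n \<Longrightarrow> error_probability K chan n R (f n) (g n) \<le> 1 / 2"
    unfolding eventually_sequentially by (meson less_imp_le)
  define c where "c = l K + 2 * (\<Sum>A\<in>receiver_sets K. l (card A))"
  obtain M where M: "c < real M * (?S R - ?S Rs)" using reals_Archimedean3[OF gap] by blast
  let ?n = "max M N"
  have "(\<Sum>B\<in>receiver_sets K. l (card B) * (real ?n * R (card B) - 1)) - l K
     \<le> (\<Sum>A\<in>receiver_sets K. l (card A) * (real ?n * Rs (card A) + 1))"
    by (rule converse_block[OF R code N l]) simp
  moreover have "(\<Sum>B\<in>receiver_sets K. l (card B) * (real ?n * R (card B) - 1))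
      = real ?n * ?S R - (\<Sum>A\<in>receiver_sets K. l (card A))"
    by (simp add: right_diff_distrib sum_subtractf sum_distrib_left mult.left_commute)
  moreover have "(\<Sum>A\<in>receiver_sets K. l (card A) * (real ?n * Rs (card A) + 1))
      = real ?n * ?S Rs + (\<Sum>A\<in>receiver_sets K. l (card A))"
    by (simp add: distrib_left sum.distrib sum_distrib_left mult.left_commute)
  ultimately have "real ?n * (?S R - ?S Rs) \<le> c"
    by (simp add: c_def right_diff_distrib)
  moreover have "real M * (?S R - ?S Rs) \<le> real ?n * (?S R - ?S Rs)"
    using gap by (intro mult_right_mono) auto
  ultimately show False using M by linarith
qed

lemma converse_capacity:
  assumes R: "R \<in> capacity_region K chan" and l: "l \<in> price_cone K"
  shows "(\<Sum>B\<in>receiver_sets K. l (card B) * R (card B)) \<le> (\<Sum>A\<in>receiver_sets K. l (card A) * Rs (card A))"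
    (is "?S R \<le> ?S Rs")
proof (rule field_le_epsilon)
  fix e :: real assume e: "0 < e"
  define L where "L = (\<Sum>B\<in>receiver_sets K. l (card B))"
  have l_pos: "0 \<le> l i" for i using l by (simp add: price_cone_def)
  then have L: "0 \<le> L" unfolding L_def by (intro sum_nonneg)
  define d where "d = e / (L + 1)"
  have d: "0 < d" and dL: "d * L \<le> e" using e L by (auto simp: d_def field_simps)
  from R d obtain R' where R': "symmetrically_achievable K chan R'" "\<And>i. i \<in> {1..K} \<Longrightarrow> \<bar>R' i - R i\<bar> < d"
    unfolding mem_capacity_region_iff by blast
  have "?S R \<le> (\<Sum>B\<in>receiver_sets K. l (card B) * (R' (card B) + d))"
  proof (intro sum_mono mult_left_mono l_pos)
    fix B assume "B \<in> receiver_sets K"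
    then have "\<bar>R' (card B) - R (card B)\<bar> < d"
      using receiver_setsD(3,4)[of B K] by (intro R'(2)) auto
    then show "R (card B) \<le> R' (card B) + d" by linarith
  qed
  also have "\<dots> = ?S R' + d * L"
    by (simp add: L_def distrib_left sum.distrib sum_distrib_left mult.commute)
  also have "\<dots> \<le> ?S Rs + e" using converse_achievable[OF R'(1) l] dL by linarith
  finally show "?S R \<le> ?S Rs + e" .
qed

end

section \<open>From weighted inequalities to the exchange region\<close>

lemma sum_receiver_sets_card:
  fixes u :: "nat \<Rightarrow> real"
  shows "(\<Sum>B\<in>receiver_sets K. u (card B)) = (\<Sum>j=1..K. real (K choose j) * u j)"
proof -
  have "(\<Sum>B\<in>receiver_sets K. u (card B)) = (\<Sum>j=1..K. \<Sum>B\<in>{B\<in>receiver_sets K. card B = j}. u (card B))"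
    using receiver_setsD(3,4) by (intro sum.group[symmetric]) auto
  also have "\<dots> = (\<Sum>j=1..K. real (K choose j) * u j)"
  proof (intro sum.cong refl)
    fix j assume "j \<in> {1..K}"
    then have "{B\<in>receiver_sets K. card B = j} = {B. B \<subseteq> {1..K} \<and> card B = j}"
      by (auto simp: receiver_sets_def)
    then have "card {B\<in>receiver_sets K. card B = j} = K choose j"
      using n_subsets[of "{1..K}" j] by simp
    then show "(\<Sum>B\<in>{B\<in>receiver_sets K. card B = j}. u (card B)) = real (K choose j) * u j" by simp
  qed
  finally show ?thesis .
qed

text \<open>Double counting of nested pairs. For \<open>i < j\<close> it gives \<open>(K choose j) *
  (j choose i) = (K choose i) * ((K - i) choose (j - i))\<close>, and the absorption identity
  \<open>i * (j choose i) = j * ((j - 1) choose (i - 1))\<close> leaves \<open>i / j\<close>. For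
  \<open>j < i\<close> the first identity with \<open>i\<close> and \<open>j\<close> exchanged
  leaves exactly \<open>1\<close>.\<close>

lemma exchange_rate_scaled:
  assumes i: "i \<in> {1..K}" and j: "j \<in> {1..K}"
  shows "exchange_rate K i j * real (K choose j) = scaled_exchange i j * real (K choose i)"
proof -
  consider "i < j" | "i = j" | "j < i" by linarith
  then show ?thesis
  proof cases
    case 1
    have "(K choose j) * (j choose i) = (K choose i) * ((K - i) choose (j - i))"
      using 1 j by (intro choose_mult) auto
    then have 2: "real (K choose j) * real (j choose i) = real (K choose i) * real ((K - i) choose (j - i))"
      by (metis of_nat_mult)
    have "i * (j choose i) = j * ((j - 1) choose (i - 1))"
      using i j binomial_absorption[of "i - 1" "j"] by simp
    then have 3: "real i * real (j choose i) = real j * real ((j - 1) choose (i - 1))"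
      by (metis of_nat_mult)
    have 4: "(j - 1) choose (j - i) = (j - 1) choose (i - 1)"
      using 1 i binomial_symmetric[of "i - 1" "j - 1"] by simp
    have pos: "0 < real ((K - i) choose (j - i))" "0 < real (j choose i)" "0 < real j"
      using 1 j by auto
    have "exchange_rate K i j * real (K choose j) * (real j * real (j choose i))
        = real ((j - 1) choose (i - 1)) / real ((K - i) choose (j - i)) * real j * (real (K choose j) * real (j choose i))"
      using 1 4 by (simp add: exchange_rate_def divide_inverse)
    also have "\<dots> = (real j * real ((j - 1) choose (i - 1))) * real (K choose i)"
      using pos unfolding 2 by simp
    also have "\<dots> = real i / real j * real (K choose i) * (real j * real (j choose i))"
      using pos unfolding 3[symmetric] by simp
    finally have "exchange_rate K i j * real (K choose j) = real i / real j * real (K choose i)"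
      by (rule mult_right_cancel[THEN iffD1, rotated]) (use pos in simp)
    moreover have "scaled_exchange i j = real i / real j"
      using 1 by (simp add: scaled_exchange_def min_def)
    ultimately show ?thesis by simp
  next
    case 2
    then show ?thesis using i by (simp add: exchange_rate_def scaled_exchange_def)
  next
    case 3
    have "(K choose i) * (i choose j) = (K choose j) * ((K - j) choose (i - j))"
      using 3 i by (intro choose_mult) auto
    then have 4: "real (K choose i) * real (i choose j) = real (K choose j) * real ((K - j) choose (i - j))"
      by (metis of_nat_mult)
    have "0 < real (i choose j)" using 3 by simp
    moreover have "i choose (i - j) = i choose j" using 3 binomial_symmetric[of j i] by simp
    ultimately have "exchange_rate K i j * real (K choose j) = real (K choose i)"
      using 3 4 by (simp add: exchange_rate_def field_simps)
    moreover have "scaled_exchange i j = 1"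
      using 3 j by (simp add: scaled_exchange_def min_def)
    ultimately show ?thesis by simp
  qed
qed

lemma mem_exchange_regionI:
  assumes ext: "R \<in> extensional {1..K}" and R: "\<And>j. j \<in> {1..K} \<Longrightarrow> 0 \<le> R j"
    and Rs: "\<And>j. j \<in> {1..K} \<Longrightarrow> 0 \<le> Rs j"
    and aff: "\<And>l. l \<in> price_cone K \<Longrightarrow>
      (\<Sum>B\<in>receiver_sets K. l (card B) * R (card B)) \<le> (\<Sum>A\<in>receiver_sets K. l (card A) * Rs (card A))"
  shows "R \<in> exchange_region K Rs"
proof -
  have "convertible K (\<lambda>i. real (K choose i) * Rs i) (\<lambda>j. real (K choose j) * R j)"
  proof (rule convertible_if_affordable)
    fix l assume "l \<in> price_cone K"
    from aff[OF this] show "(\<Sum>i=1..K. l i * (real (K choose i) * R i)) \<le> (\<Sum>i=1..K. l i * (real (K choose i) * Rs i))"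
      using sum_receiver_sets_card[of "\<lambda>j. l j * R j" K] sum_receiver_sets_card[of "\<lambda>j. l j * Rs j" K]
      by (simp add: mult.left_commute)
  qed (use R Rs in auto)
  then obtain r where r: "\<And>i j. i \<in> {1..K} \<Longrightarrow> j \<in> {1..K} \<Longrightarrow> 0 \<le> r i j"
    and supplied: "\<And>i. i \<in> {1..K} \<Longrightarrow> (\<Sum>j=1..K. r i j) \<le> real (K choose i) * Rs i"
    and demanded: "\<And>j. j \<in> {1..K} \<Longrightarrow> real (K choose j) * R j \<le> (\<Sum>i=1..K. scaled_exchange i j * r i j)"
    unfolding convertible_def by blast
  \<comment> \<open>Back from total rates to the rate of one message: there are
    \<open>K choose i\<close> sets of size \<open>i\<close>.\<close>
  define s where "s i j = r i j / real (K choose i)" for i j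
  have pos: "0 < real (K choose i)" if "i \<in> {1..K}" for i using that by simp
  have "0 \<le> s i j" if "i \<in> {1..K}" "j \<in> {1..K}" for i j
    using r[OF that] by (simp add: s_def)
  moreover have "(\<Sum>j=1..K. s i j) \<le> Rs i" if i: "i \<in> {1..K}" for i
    using supplied[OF i] pos[OF i] by (simp add: s_def sum_divide_distrib[symmetric] divide_le_eq mult.commute)
  moreover have "R j \<le> (\<Sum>i=1..K. exchange_rate K i j * s i j)" if j: "j \<in> {1..K}" for j
  proof -
    have "real (K choose j) * R j \<le> (\<Sum>i=1..K. scaled_exchange i j * r i j)" by (rule demanded[OF j])
    also have "\<dots> = (\<Sum>i=1..K. real (K choose j) * (exchange_rate K i j * s i j))"
    proof (intro sum.cong refl)
      fix i assume i: "i \<in> {1..K}"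
      have "scaled_exchange i j * r i j = scaled_exchange i j * real (K choose i) * s i j"
        using pos[OF i] by (simp add: s_def)
      then show "scaled_exchange i j * r i j = real (K choose j) * (exchange_rate K i j * s i j)"
        unfolding exchange_rate_scaled[OF i j, symmetric] by (simp add: mult_ac)
    qed
    also have "\<dots> = real (K choose j) * (\<Sum>i=1..K. exchange_rate K i j * s i j)"
      by (rule sum_distrib_left[symmetric])
    finally show ?thesis using pos[OF j] by (rule mult_left_le_imp_le)
  qed
  ultimately show ?thesis unfolding exchange_region_def using ext R by blast
qed

lemma (in link_channel) capacity_region_chan_subset: "capacity_region K chan \<subseteq> exchange_region K Rs"
proof
  fix R assume R: "R \<in> capacity_region K chan"
  show "R \<in> exchange_region K Rs"
  proof (rule mem_exchange_regionI)
    show "R \<in> extensional {1..K}" using R by (simp add: mem_capacity_region_iff)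
    show "0 \<le> R j" if j: "j \<in> {1..K}" for j
    proof (rule field_le_epsilon)
      fix e :: real assume "0 < e"
      then obtain R' where "symmetrically_achievable K chan R'" "\<bar>R' j - R j\<bar> < e"
        using R j unfolding mem_capacity_region_iff by blast
      moreover from this have "0 \<le> R' j" using j by (auto simp: symmetrically_achievable_def PiE_iff)
      ultimately show "0 \<le> R j + e" by linarith
    qed
    show "0 \<le> Rs j" if "j \<in> {1..K}" for j using Rs that by (auto simp: PiE_iff)
  qed (rule converse_capacity[OF R])
qed

text \<open>An infinite type contains a copy of the naturals, and these number the countably many
  signals. Input letters outside the copy are mapped to some signal as well, which is why the locale
  asks of \<open>inp\<close> only that its range cover the signals.\<close>

lemma exists_link_channel:
  assumes "infinite (UNIV :: 'a set)" "infinite (UNIV :: 'b set)" "Rs \<in> {1..K} \<rightarrow>\<^sub>E {0..}"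
  shows "\<exists>(inp :: 'a \<Rightarrow> nat set \<Rightarrow> nat) (outp :: (nat set \<Rightarrow> nat) \<Rightarrow> 'b). link_channel K Rs inp outp"
proof -
  obtain a :: "nat \<Rightarrow> 'a" where a: "inj a" using assms(1) unfolding infinite_iff_countable_subset by blast
  obtain b :: "nat \<Rightarrow> 'b" where b: "inj b" using assms(2) unfolding infinite_iff_countable_subset by blast
  have cs: "countable (signals K)" unfolding signals_def by (intro countable_PiE) auto
  let ?inp = "\<lambda>x. from_nat_into (signals K) (inv a x)"
  let ?outp = "\<lambda>v. b (to_nat_on (signals K) v)"
  have "link_channel K Rs ?inp ?outp"
  proof
    show "Rs \<in> {1..K} \<rightarrow>\<^sub>E {0..}" by (rule assms)
    show "signals K \<subseteq> range ?inp"
    proof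
      fix v assume "v \<in> signals K"
      then have "v = ?inp (a (to_nat_on (signals K) v))" using a cs by simp
      then show "v \<in> range ?inp" by (rule range_eqI)
    qed
    show "inj_on ?outp (signals K)"
      using inj_on_to_nat_on[OF cs] b by (auto simp: inj_on_def)
  qed
  then show ?thesis by blast
qed

theorem theorem1:
  fixes K :: nat and Rs :: "nat \<Rightarrow> real"
  assumes "infinite (UNIV :: 'a set)" and "infinite (UNIV :: 'b set)"
    and "K \<ge> 1"
    and "Rs \<in> {1..K} \<rightarrow>\<^sub>E {0..}"
  shows "is_latent_capacity_region TYPE(('a, 'b) channel) K Rs (exchange_region K Rs)"
proof -
  obtain inp :: "'a \<Rightarrow> nat set \<Rightarrow> nat" and outp :: "(nat set \<Rightarrow> nat) \<Rightarrow> 'b" where "link_channel K Rs inp outp"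
    using exists_link_channel[OF assms(1,2,4)] by blast
  then interpret link_channel K Rs inp outp .
  show ?thesis
    unfolding is_latent_capacity_region_def
  proof (intro conjI allI impI exI[of _ "{chan}"])
    show "exchange_region K Rs \<subseteq> capacity_region K p"
      if "is_broadcast_channel K p" "Rs \<in> capacity_region K p" for p :: "('a, 'b) channel"
      using that by (rule exchange_region_subset_capacity_region)
    show "\<forall>p\<in>{chan}. is_broadcast_channel K p \<and> Rs \<in> capacity_region K p"
      using is_broadcast_channel_chan Rs_in_capacity_region by blast
    show "(\<Inter>p\<in>{chan}. capacity_region K p) \<subseteq> exchange_region K Rs"
      using capacity_region_chan_subset by simp
  qed
qed

end
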